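(* Consider a finite-state channel with input $x^N$, output $y^N$ and time-invariant deterministic feedback $z_i=z(y_i)$. Its feedback capacity $C_{FB}$ satisfies $$C_{FB}\le\lim_{N\to\infty}\frac1N\max_{Q(x^N\|z^{N-1})}I(X^N\to Y^N).$$
   Context: Finite-state channel (FSC): finite input, output and state alphabets $\mathcal X,\mathcal Y,\mathcal S$ and a time-invariant kernel $P(y_i,s_i|x_i,s_{i-1})$ with $P(y_i,s_i|x^i,s^{i-1},y^{i-1})=P(y_i,s_i|x_i,s_{i-1})$; the initial state $S_0$ has a given distribution $P(s_0)$ and is independent of the message. Notation: $x^i=(x_1,\dots,x_i)$. Feedback: $z:\mathcal Y\to\mathcal Z$ is a fixed function into a finite set, $z_i=z(y_i)$, and at time $i$ the encoder knows $z^{i-1}$. In expressions involving both $y^N$ and $z^{N-1}$, $z^{N-1}=(z(y_1),\dots,z(y_{N-1}))$. An $(N,M)$ code consists of encoding functions $x_i(m,z^{i-1})$, $i=1,\dots,N$, $m\in\{1,\dots,M\}$, and a decoder $\hat m(y^N)$; $P_{e,m}(s_0)$ is the probability of $\hat m(Y^N)\neq m$ when $m$ is sent and the initial state is $s_0$. A rate $R$ is achievable if there is a sequence of $(N,\lceil 2^{NR}\rceil)$ codes with $\max_m P_{e,m}(s_0)\to0$ as $N\to\infty$ for all initial states $s_0$. $C_{FB}$ is the supremum of achievable rates. Causal conditioning: $Q(x^N\|z^{N-1})=\prod_{i=1}^N Q(x_i|x^{i-1},z^{i-1})$, with arbitrary conditional probability mass functions as factors (the maximum is over all such families); $P(y^N\|x^N)=\prod_{i=1}^N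 P(y_i|x^i,y^{i-1})=\sum_{s_0}P(s_0)\sum_{s^N}\prod_{i=1}^N P(y_i,s_i|x_i,s_{i-1})$. Given $Q$, the joint law is $P(x^N,y^N)=Q(x^N\|z^{N-1})P(y^N\|x^N)$, and the directed information is $I(X^N\to Y^N)=\sum_{i=1}^N I(X^i;Y_i|Y^{i-1})$ under this law. *)

theory Defs
  imports "HOL-Probability.Probability"
begin

text \<open>
  Finite alphabets are finite types. A finite-state channel is a kernel
  \<open>W :: 'x \<Rightarrow> 's \<Rightarrow> ('y \<times> 's) pmf\<close>, where \<open>pmf (W x s') (y, s)\<close> is \<open>P(y, s | x, s')\<close> with \<open>s'\<close> the
  previous state. Sequences are lists, and time is 0-based: \<open>xs ! i\<close> is the \<open>(i+1)\<close>-st symbol and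
  \<open>take i xs\<close> is the block of the first \<open>i\<close> symbols.
\<close>

definition blocks :: "nat \<Rightarrow> 'a list set" where
  "blocks N = {xs. length xs = N}"

text \<open>In \<open>(s0 # ss) ! i\<close> the state list is shifted, so it is the state preceding \<open>ss ! i\<close>.\<close>

definition chan_from ::
  "('x \<Rightarrow> 's::finite \<Rightarrow> ('y \<times> 's) pmf) \<Rightarrow> 's \<Rightarrow> 'x list \<Rightarrow> 'y list \<Rightarrow> real" where
  "chan_from W s0 xs ys =
     (\<Sum>ss\<in>blocks (length xs). \<Prod>i<length xs. pmf (W (xs ! i) ((s0 # ss) ! i)) (ys ! i, ss ! i))"

definition chan ::
  "('x \<Rightarrow> 's::finite \<Rightarrow> ('y \<times> 's) pmf) \<Rightarrow> 's pmf \<Rightarrow> 'x list \<Rightarrow> 'y list \<Rightarrow> real" where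
  "chan W P0 xs ys = (\<Sum>s0\<in>UNIV. pmf P0 s0 * chan_from W s0 xs ys)"

text \<open>
  A family of conditional mass functions \<open>Q(x_i | x^(i-1), z^(i-1))\<close> is a function of the two
  past blocks; the time index is determined by their common length.
\<close>

type_synonym ('x, 'z) input_policy = "'x list \<Rightarrow> 'z list \<Rightarrow> 'x pmf"

definition causal_input :: "('x, 'z) input_policy \<Rightarrow> 'x list \<Rightarrow> 'z list \<Rightarrow> real" where
  "causal_input Q xs zs = (\<Prod>i<length xs. pmf (Q (take i xs) (take i zs)) (xs ! i))"

definition joint_mass ::
  "('x \<Rightarrow> 's::finite \<Rightarrow> ('y \<times> 's) pmf) \<Rightarrow> 's pmf \<Rightarrow> ('y \<Rightarrow> 'z) \<Rightarrow> nat \<Rightarrow> ('x, 'z) input_policy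
     \<Rightarrow> 'x list \<times> 'y list \<Rightarrow> real" where
  "joint_mass W P0 z N Q = (\<lambda>(xs, ys).
     if xs \<in> blocks N \<and> ys \<in> blocks N
     then causal_input Q xs (map z (take (N - 1) ys)) * chan W P0 xs ys else 0)"

text \<open>That \<open>joint_mass\<close> is a mass function, so that \<open>embed_pmf\<close> is meaningful here, is
  \<open>pmf_joint_law\<close> below.\<close>

definition joint_law ::
  "('x::finite \<Rightarrow> 's::finite \<Rightarrow> ('y::finite \<times> 's) pmf) \<Rightarrow> 's pmf \<Rightarrow> ('y \<Rightarrow> 'z) \<Rightarrow> nat
     \<Rightarrow> ('x, 'z) input_policy \<Rightarrow> ('x list \<times> 'y list) pmf" where
  "joint_law W P0 z N Q = embed_pmf (joint_mass W P0 z N Q)"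

text \<open>
  Conditional mutual information in bits, \<open>I(X; Y | Z)\<close> under \<open>p\<close>, for random variables with finite
  range. The measurable spaces are those of the library's notation \<open>\<I>(X ; Y | Z)\<close>.
\<close>

definition cond_mi :: "'a pmf \<Rightarrow> ('a \<Rightarrow> 'b) \<Rightarrow> ('a \<Rightarrow> 'c) \<Rightarrow> ('a \<Rightarrow> 'd) \<Rightarrow> real" where
  "cond_mi p X Y Z = prob_space.conditional_mutual_information (measure_pmf p) 2
     (count_space (range X)) (count_space (range Y)) (count_space (range Z)) X Y Z"

definition directed_info :: "nat \<Rightarrow> ('x list \<times> 'y list) pmf \<Rightarrow> real" where
  "directed_info N p = (\<Sum>i<N.
     cond_mi p (\<lambda>(xs, ys). take (Suc i) xs) (\<lambda>(xs, ys). ys ! i) (\<lambda>(xs, ys). take i ys))"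

text \<open>The values below are bounded by \<open>N log |Y|\<close>, and their supremum is a maximum, since directed
  information is a continuous function of finitely many of the mass functions in \<open>Q\<close>.\<close>

definition max_directed_info ::
  "('x::finite \<Rightarrow> 's::finite \<Rightarrow> ('y::finite \<times> 's) pmf) \<Rightarrow> 's pmf \<Rightarrow> ('y \<Rightarrow> 'z) \<Rightarrow> nat \<Rightarrow> real" where
  "max_directed_info W P0 z N =
     (SUP Q :: ('x, 'z) input_policy. directed_info N (joint_law W P0 z N Q))"

text \<open>
  Messages are \<open>1, \<dots>, M\<close>. An encoder maps a message and the feedback received so far to the next
  input; again the time index is the length of the feedback block plus one.
\<close>

type_synonym ('x, 'y, 'z) code = "(nat \<Rightarrow> 'z list \<Rightarrow> 'x) \<times> ('y list \<Rightarrow> nat)"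

definition is_code :: "nat \<Rightarrow> nat \<Rightarrow> ('x, 'y, 'z) code \<Rightarrow> bool" where
  "is_code N M c \<longleftrightarrow> (\<forall>ys\<in>blocks N. snd c ys \<in> {1..M})"

definition codeword :: "('y \<Rightarrow> 'z) \<Rightarrow> ('x, 'y, 'z) code \<Rightarrow> nat \<Rightarrow> 'y list \<Rightarrow> 'x list" where
  "codeword z c m ys = map (\<lambda>i. fst c m (map z (take i ys))) [0..<length ys]"

definition error_prob ::
  "('x \<Rightarrow> 's::finite \<Rightarrow> ('y::finite \<times> 's) pmf) \<Rightarrow> ('y \<Rightarrow> 'z) \<Rightarrow> nat \<Rightarrow> ('x, 'y, 'z) code
     \<Rightarrow> nat \<Rightarrow> 's \<Rightarrow> real" where
  "error_prob W z N c m s0 =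
     (\<Sum>ys | ys \<in> blocks N \<and> snd c ys \<noteq> m. chan_from W s0 (codeword z c m ys) ys)"

definition num_messages :: "nat \<Rightarrow> real \<Rightarrow> nat" where
  "num_messages N R = nat \<lceil>2 powr (real N * R)\<rceil>"

definition achievable ::
  "('x \<Rightarrow> 's::finite \<Rightarrow> ('y::finite \<times> 's) pmf) \<Rightarrow> ('y \<Rightarrow> 'z) \<Rightarrow> real \<Rightarrow> bool" where
  "achievable W z R \<longleftrightarrow>
     (\<exists>c :: nat \<Rightarrow> ('x, 'y, 'z) code.
        (\<forall>N. is_code N (num_messages N R) (c N)) \<and>
        (\<forall>s0. (\<lambda>N. MAX m\<in>{1..num_messages N R}. error_prob W z N (c N) m s0) \<longlonglongrightarrow> 0))"

text \<open>Every \<open>R \<le> 0\<close> is achievable (with one message), and achievable rates are at most \<open>log |Y|\<close>,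
  so the real supremum is proper.\<close>

definition feedback_capacity ::
  "('x \<Rightarrow> 's::finite \<Rightarrow> ('y::finite \<times> 's) pmf) \<Rightarrow> ('y \<Rightarrow> 'z) \<Rightarrow> real" where
  "feedback_capacity W z = Sup {R. achievable W z R}"

lemma finite_blocks [simp]: "finite (blocks N :: 'a::finite list set)"
  using finite_lists_length_eq[of "UNIV :: 'a set" N] by (simp add: blocks_def)

lemma blocks_0: "blocks 0 = {[]}"
  by (auto simp: blocks_def)

lemma sum_blocks_Suc:
  "(\<Sum>xs\<in>blocks (Suc N). f xs) = (\<Sum>xs\<in>blocks N. \<Sum>x\<in>UNIV. f (xs @ [x :: 'a::finite]))"
proof -
  have last: "butlast xs @ [last xs] = xs" if "length xs = Suc N" for xs :: "'a list"
    using that by (intro append_butlast_last_id) auto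
  have "(\<Sum>xs\<in>blocks (Suc N). f xs) = (\<Sum>(xs, x)\<in>blocks N \<times> UNIV. f (xs @ [x]))"
    by (rule sum.reindex_bij_witness[of _ "\<lambda>(xs, x). xs @ [x]" "\<lambda>xs. (butlast xs, last xs)"])
      (auto simp: blocks_def last)
  thus ?thesis by (simp add: sum.cartesian_product)
qed

lemma causal_input_snoc:
  assumes "length zs = length xs"
  shows "causal_input Q (xs @ [x]) (zs @ zs') = causal_input Q xs zs * pmf (Q xs zs) x"
  using assms by (simp add: causal_input_def nth_append)

lemma causal_input_take:
  assumes "xs \<in> blocks N" "ys \<in> blocks N"
  shows "causal_input Q xs (map z (take (N - 1) ys)) = causal_input Q xs (map z ys)"
  using assms unfolding causal_input_def blocks_def
  by (intro prod.cong refl) (auto simp: take_map min_def)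

lemma chan_from_snoc:
  assumes "length ys = length xs"
  shows "chan_from W s0 (xs @ [x]) (ys @ [y]) =
    (\<Sum>ss\<in>blocks (length xs). \<Sum>s\<in>UNIV.
       (\<Prod>i<length xs. pmf (W (xs ! i) ((s0 # ss) ! i)) (ys ! i, ss ! i)) *
       pmf (W x ((s0 # ss) ! length xs)) (y, s))"
  using assms unfolding chan_from_def length_append list.size add_0_right add_Suc_right sum_blocks_Suc
  by (intro sum.cong refl) (auto simp: blocks_def nth_append nth_Cons' intro!: prod.cong)

lemma sum_chan_from_snoc:
  fixes W :: "'x \<Rightarrow> 's::finite \<Rightarrow> ('y::finite \<times> 's) pmf"
  assumes "length ys = length xs"
  shows "(\<Sum>y\<in>UNIV. chan_from W s0 (xs @ [x]) (ys @ [y])) = chan_from W s0 xs ys"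
proof -
  have 1: "(\<Sum>y\<in>UNIV. \<Sum>s\<in>UNIV. pmf p (y, s)) = 1" for p :: "('y \<times> 's) pmf"
    by (simp add: sum.cartesian_product UNIV_Times_UNIV sum_pmf_eq_1)
  have "(\<Sum>y\<in>UNIV. chan_from W s0 (xs @ [x]) (ys @ [y])) =
    (\<Sum>ss\<in>blocks (length xs). (\<Prod>i<length xs. pmf (W (xs ! i) ((s0 # ss) ! i)) (ys ! i, ss ! i)) *
       (\<Sum>y\<in>UNIV. \<Sum>s\<in>UNIV. pmf (W x ((s0 # ss) ! length xs)) (y, s)))"
    unfolding chan_from_snoc[OF assms]
    by (subst sum.swap) (simp add: sum_distrib_left)
  also have "\<dots> = chan_from W s0 xs ys"
    by (simp add: 1 chan_from_def)
  finally show ?thesis .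
qed

lemma sum_joint_from:
  fixes W :: "'x::finite \<Rightarrow> 's::finite \<Rightarrow> ('y::finite \<times> 's) pmf"
  shows "(\<Sum>xs\<in>blocks N. \<Sum>ys\<in>blocks N. causal_input Q xs (map z ys) * chan_from W s0 xs ys) = 1"
proof (induction N)
  case 0
  show ?case by (simp add: blocks_0 causal_input_def chan_from_def)
next
  case (Suc N)
  have "(\<Sum>xs\<in>blocks (Suc N). \<Sum>ys\<in>blocks (Suc N). causal_input Q xs (map z ys) * chan_from W s0 xs ys)
      = (\<Sum>xs\<in>blocks N. \<Sum>x\<in>UNIV. \<Sum>ys\<in>blocks N. \<Sum>y\<in>UNIV.
           causal_input Q (xs @ [x]) (map z (ys @ [y])) * chan_from W s0 (xs @ [x]) (ys @ [y]))"
    by (simp only: sum_blocks_Suc)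
  also have "\<dots> = (\<Sum>xs\<in>blocks N. \<Sum>x\<in>UNIV. \<Sum>ys\<in>blocks N.
           causal_input Q xs (map z ys) * chan_from W s0 xs ys * pmf (Q xs (map z ys)) x)"
  proof (intro sum.cong refl)
    fix xs :: "'x list" and x :: 'x and ys :: "'y list"
    assume *: "xs \<in> blocks N" "ys \<in> blocks N"
    hence len: "length ys = length xs" by (simp add: blocks_def)
    show "(\<Sum>y\<in>UNIV. causal_input Q (xs @ [x]) (map z (ys @ [y])) * chan_from W s0 (xs @ [x]) (ys @ [y])) =
      causal_input Q xs (map z ys) * chan_from W s0 xs ys * pmf (Q xs (map z ys)) x"
      using len sum_chan_from_snoc[OF len, of W s0 x]
      by (simp add: causal_input_snoc mult_ac flip: sum_distrib_left)
  qed
  also have "\<dots> = (\<Sum>xs\<in>blocks N. \<Sum>ys\<in>blocks N. \<Sum>x\<in>UNIV.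
           causal_input Q xs (map z ys) * chan_from W s0 xs ys * pmf (Q xs (map z ys)) x)"
    by (intro sum.cong refl sum.swap)
  also have "\<dots> = (\<Sum>xs\<in>blocks N. \<Sum>ys\<in>blocks N. causal_input Q xs (map z ys) * chan_from W s0 xs ys)"
    by (simp add: sum_pmf_eq_1 flip: sum_distrib_left)
  finally show ?case using Suc.IH by simp
qed

lemma chan_from_nonneg: "0 \<le> chan_from W s0 xs ys"
  by (auto simp: chan_from_def intro!: sum_nonneg prod_nonneg)

lemma joint_mass_nonneg: "0 \<le> joint_mass W P0 z N Q w"
  by (cases w) (auto simp: joint_mass_def causal_input_def chan_def
      intro!: mult_nonneg_nonneg sum_nonneg prod_nonneg chan_from_nonneg)

lemma sum_joint_mass:
  fixes W :: "'x::finite \<Rightarrow> 's::finite \<Rightarrow> ('y::finite \<times> 's) pmf"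
  shows "(\<Sum>w\<in>blocks N \<times> blocks N. joint_mass W P0 z N Q w) = 1"
proof -
  have "(\<Sum>w\<in>blocks N \<times> blocks N. joint_mass W P0 z N Q w) =
    (\<Sum>xs\<in>blocks N. \<Sum>ys\<in>blocks N. \<Sum>s0\<in>UNIV.
       pmf P0 s0 * (causal_input Q xs (map z ys) * chan_from W s0 xs ys))"
    by (subst sum.cartesian_product, intro sum.cong refl)
      (auto simp: joint_mass_def chan_def sum_distrib_left causal_input_take[simplified] mult_ac)
  also have "\<dots> = (\<Sum>xs\<in>blocks N. \<Sum>s0\<in>UNIV. \<Sum>ys\<in>blocks N.
       pmf P0 s0 * (causal_input Q xs (map z ys) * chan_from W s0 xs ys))"
    by (intro sum.cong refl sum.swap)
  also have "\<dots> = (\<Sum>s0\<in>UNIV. \<Sum>xs\<in>blocks N. \<Sum>ys\<in>blocks N.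
       pmf P0 s0 * (causal_input Q xs (map z ys) * chan_from W s0 xs ys))"
    by (rule sum.swap)
  also have "\<dots> = (\<Sum>s0\<in>UNIV. pmf P0 s0 *
       (\<Sum>xs\<in>blocks N. \<Sum>ys\<in>blocks N. causal_input Q xs (map z ys) * chan_from W s0 xs ys))"
    by (simp add: sum_distrib_left)
  also have "\<dots> = 1"
    by (simp add: sum_joint_from sum_pmf_eq_1)
  finally show ?thesis .
qed

lemma pmf_joint_law: "pmf (joint_law W P0 z N Q) w = joint_mass W P0 z N Q w"
  unfolding joint_law_def
proof (rule pmf_embed_pmf)
  let ?f = "\<lambda>w. ennreal (joint_mass W P0 z N Q w)"
  have "(\<integral>\<^sup>+w. ?f w \<partial>count_space UNIV) = (\<Sum>w\<in>blocks N \<times> blocks N. ?f w)"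
    by (rule nn_integral_count_space') (auto simp: joint_mass_def split: if_splits)
  also have "\<dots> = ennreal (\<Sum>w\<in>blocks N \<times> blocks N. joint_mass W P0 z N Q w)"
    by (rule sum_ennreal) (rule joint_mass_nonneg)
  finally show "(\<integral>\<^sup>+w. ?f w \<partial>count_space UNIV) = 1"
    by (simp add: sum_joint_mass)
qed (rule joint_mass_nonneg)

text \<open>On variables with finite range, \<open>cond_mi\<close> is the usual finite sum.\<close>

lemma cond_mi_eq:
  fixes X :: "'a \<Rightarrow> 'b" and Y :: "'a \<Rightarrow> 'c" and Z :: "'a \<Rightarrow> 'd"
  assumes "finite (range X)" "finite (range Y)" "finite (range Z)"
  shows "cond_mi p X Y Z = (\<Sum>(x, y, z)\<in>range (\<lambda>w. (X w, Y w, Z w)).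
     measure_pmf.prob p {w. X w = x \<and> Y w = y \<and> Z w = z} *
     log 2 (measure_pmf.prob p {w. X w = x \<and> Y w = y \<and> Z w = z} /
       (measure_pmf.prob p {w. X w = x \<and> Z w = z} *
        (measure_pmf.prob p {w. Y w = y \<and> Z w = z} / measure_pmf.prob p {w. Z w = z}))))"
proof -
  interpret information_space "measure_pmf p" 2
    by unfold_locales simp
  have sd: "simple_distributed (measure_pmf p) V (\<lambda>v. measure_pmf.prob p {w. V w = v})"
    if "finite (range V)" for V :: "'a \<Rightarrow> 'e"
    using that by (intro measure_pmf.simple_distributedI) (auto simp: simple_function_def vimage_def)
  have fin: "finite (range (\<lambda>w. (V w, V' w)))" if "finite (range V)" "finite (range V')"
    for V :: "'a \<Rightarrow> 'e" and V' :: "'a \<Rightarrow> 'f"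
    by (rule finite_subset[of _ "range V \<times> range V'"]) (use that in auto)
  note f = assms fin[OF assms(2,3)] fin[OF assms(1,3)] fin[OF assms(1) fin[OF assms(2,3)]]
  show ?thesis
    using conditional_mutual_information_eq[OF sd[OF f(3)] sd[OF f(4)] sd[OF f(5)] sd[OF f(6)]]
    by (simp add: cond_mi_def)
qed

lemma finite_range_take:
  "finite (range (\<lambda>(xs :: 'x::finite list, ys :: 'y list). take i xs))"
  "finite (range (\<lambda>(xs :: 'y list, ys :: 'x::finite list). take i ys))"
  by (rule finite_subset[OF _ finite_lists_length_le[of UNIV i]]; auto)+

end

theory Submission
  imports Defs
begin

text \<open>
  Write \<open>D_N(Q)\<close> for the directed information of the first \<open>N\<close> steps under the input policy \<open>Q\<close>, and
  \<open>a_N\<close> for its supremum over \<open>Q\<close>. It is the expectation of \<open>log (P(y^N || x^N) / P(y^N))\<close>.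

  The inequality is Fano's: a code with equiprobable messages is a mixture of deterministic policies,
  a mixture of policies is again a policy, and the directed information of the latter is the mutual
  information between message and output.

  Existence of the limit is the harder part: the policy cannot depend on the initial state, so that
  no sub- or superadditivity of \<open>a\<close> is evident. View the channel as a partially observed control
  problem. At time \<open>n\<close> the encoder holds a belief about the state \<open>s_n\<close>. Round this belief to one of
  finitely many cells \<open>k\<close>. Telling the decoder both \<open>k\<close> and \<open>s_n\<close> costs a constant, and given \<open>k\<close> the
  encoder's past is nearly independent of \<open>s_n\<close>, so that all continuations in a cell may be replaced
  by their mixture \<open>R k\<close>. Hence the information gained in the \<open>T\<close> steps after \<open>n\<close> is, up to a constant
  and \<open>e T\<close>, the sum over \<open>k, s\<close> of \<open>P(k, s_n = s)\<close> times the directed information of \<open>R k\<close> started in \<open>s\<close>.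
  It depends on \<open>n\<close> and \<open>Q\<close> only through a vector \<open>P(k, s)\<close> in a compact set; so, up to \<open>e T\<close>,
  it can already be gained after one of finitely many starting times. Therefore every block of \<open>T\<close>
  steps gains at most \<open>a_(n0 + T) + C + e T\<close> with \<open>n0\<close> and \<open>C\<close> independent of \<open>T\<close>, and
  \<open>limsup a_N / N \<le> liminf a_N / N + e\<close>.
\<close>

section \<open>Causal conditioning and the forward channel law\<close>

text \<open>Gibbs' inequality, with slack in \<open>f\<close> and in the total mass of \<open>q\<close> so that each information
  inequality below is one instance with a suitable \<open>q\<close>.\<close>

lemma sum_mult_log_nonneg:
  fixes p q f :: "'i \<Rightarrow> real"
  assumes "\<And>i. i \<in> I \<Longrightarrow> 0 \<le> p i" "\<And>i. i \<in> I \<Longrightarrow> 0 \<le> q i"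
    and f: "\<And>i. i \<in> I \<Longrightarrow> 0 < p i \<Longrightarrow> 0 < q i \<and> log 2 (p i / q i) \<le> f i"
    and "sum q I \<le> sum p I"
  shows "0 \<le> (\<Sum>i\<in>I. p i * f i)"
proof -
  have "(p i - q i) / ln 2 \<le> p i * f i" if i: "i \<in> I" for i
  proof (cases "p i = 0")
    case True
    thus ?thesis using assms(2)[OF i] by (simp add: divide_le_0_iff)
  next
    case False
    hence p: "0 < p i" using assms(1)[OF i] by simp
    with f[OF i] have q: "0 < q i" and le: "log 2 (p i / q i) \<le> f i" by auto
    have "ln (q i / p i) \<le> q i / p i - 1" using p q by (intro ln_le_minus_one) auto
    hence "p i * ln (q i / p i) \<le> p i * (q i / p i - 1)" using p by (intro mult_left_mono) auto
    hence "p i - q i \<le> p i * ln (p i / q i)" using p q by (simp add: ln_div algebra_simps)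
    hence "(p i - q i) / ln 2 \<le> p i * log 2 (p i / q i)"
      by (simp add: log_def divide_right_mono)
    also have "\<dots> \<le> p i * f i" using le p by (intro mult_left_mono) auto
    finally show ?thesis .
  qed
  hence "(\<Sum>i\<in>I. (p i - q i) / ln 2) \<le> (\<Sum>i\<in>I. p i * f i)" by (rule sum_mono)
  moreover have "(\<Sum>i\<in>I. (p i - q i) / ln 2) = (sum p I - sum q I) / ln 2"
    by (simp add: sum_divide_distrib[symmetric] sum_subtractf)
  ultimately show ?thesis using assms(4) by (smt (verit) divide_nonneg_pos ln_gt_zero)
qed

section \<open>Block sums and mixtures of causal input laws\<close>

lemma sum_blocks_add:
  "(\<Sum>xs\<in>blocks (n + T). f xs) = (\<Sum>xs\<in>blocks n. \<Sum>xs'\<in>blocks T. f (xs @ xs'))"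
proof -
  have "(\<Sum>xs\<in>blocks (n + T). f xs) = (\<Sum>(xs, xs')\<in>blocks n \<times> blocks T. f (xs @ xs'))"
    by (rule sum.reindex_bij_witness[of _ "\<lambda>(xs, xs'). xs @ xs'" "\<lambda>xs. (take n xs, drop n xs)"])
      (auto simp: blocks_def)
  thus ?thesis by (simp add: sum.cartesian_product)
qed

lemma map_in_blocks: "ys \<in> blocks n \<Longrightarrow> map f ys \<in> blocks n"
  by (simp add: blocks_def)

lemma card_blocks: "card (blocks N :: 'a::finite list set) = CARD('a) ^ N"
  using card_lists_length_eq[of "UNIV :: 'a set" N] by (simp add: blocks_def)

lemma causal_input_nonneg: "0 \<le> causal_input Q xs zs"
  by (simp add: causal_input_def prod_nonneg)

lemma causal_input_Nil [simp]: "causal_input Q [] zs = 1"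
  by (simp add: causal_input_def)

lemma causal_input_append:
  assumes "length zs = length xs"
  shows "causal_input Q (xs @ xs') (zs @ zs') =
    causal_input Q xs zs * causal_input (\<lambda>a b. Q (xs @ a) (zs @ b)) xs' zs'"
proof -
  have "causal_input Q (xs @ xs') (zs @ zs') =
    (\<Prod>i<length xs + length xs'. pmf (Q (take i (xs @ xs')) (take i (zs @ zs'))) ((xs @ xs') ! i))"
    by (simp add: causal_input_def)
  also have "\<dots> = (\<Prod>i<length xs. pmf (Q (take i (xs @ xs')) (take i (zs @ zs'))) ((xs @ xs') ! i)) *
      (\<Prod>i<length xs'. pmf (Q (take (length xs + i) (xs @ xs')) (take (length xs + i) (zs @ zs')))
         ((xs @ xs') ! (length xs + i)))"
    by (simp add: lessThan_atLeast0 prod.atLeastLessThan_concat[of 0 "length xs" "length xs + length xs'", symmetric]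
        prod.shift_bounds_nat_ivl[of _ 0 "length xs", simplified] add.commute
        prod.atLeastLessThan_shift_0[of _ "length xs" "length xs + length xs'"])
  finally show ?thesis
    using assms by (simp add: causal_input_def nth_append)
qed

lemma causal_input_cong:
  assumes "length zs = length xs"
    and "\<And>a b. length a = length b \<Longrightarrow> length a < length xs \<Longrightarrow> Q a b = Q' a b"
  shows "causal_input Q xs zs = causal_input Q' xs zs"
  using assms by (simp add: causal_input_def)

lemma sum_causal_input:
  fixes Q :: "('x::finite, 'z) input_policy"
  shows "zs \<in> blocks N \<Longrightarrow> (\<Sum>xs\<in>blocks N. causal_input Q xs zs) = 1"
proof (induction N arbitrary: zs)
  case 0
  thus ?case by (simp add: blocks_0)
next
  case (Suc N)
  then obtain zs1 z1 where zs: "zs = zs1 @ [z1]" "zs1 \<in> blocks N"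
    by (cases zs rule: rev_cases) (auto simp: blocks_def)
  have "(\<Sum>xs\<in>blocks (Suc N). causal_input Q xs zs) =
    (\<Sum>xs\<in>blocks N. \<Sum>x\<in>UNIV. causal_input Q xs zs1 * pmf (Q xs zs1) x)"
    unfolding sum_blocks_Suc using zs
    by (intro sum.cong refl) (auto simp: blocks_def causal_input_snoc)
  also have "\<dots> = 1"
    using Suc.IH[OF zs(2)] by (simp add: sum_pmf_eq_1 flip: sum_distrib_left)
  finally show ?case .
qed

text \<open>The mixing policy draws the next input from the posterior mixture of the
  \<open>Q j\<close>, the weight of \<open>j\<close> being updated by the inputs seen so far. Given
  the inputs, the feedback carries no further information on \<open>j\<close>, so the posterior
  depends on the two past blocks alone. The weights need not sum to 1: they will be masses of the
  pasts in a cell, or message probabilities.\<close>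

lemma exists_mixture_policy:
  fixes w :: "'j \<Rightarrow> real" and Q :: "'j \<Rightarrow> ('x::finite, 'z) input_policy"
  assumes "finite J" and w: "\<And>j. j \<in> J \<Longrightarrow> 0 \<le> w j"
  shows "\<exists>R :: ('x, 'z) input_policy. \<forall>xs zs. length zs = length xs \<longrightarrow>
    sum w J * causal_input R xs zs = (\<Sum>j\<in>J. w j * causal_input (Q j) xs zs)"
proof -
  define v where "v j xs zs = w j * causal_input (Q j) xs zs" for j xs zs
  have v: "0 \<le> v j xs zs" if "j \<in> J" for j xs zs
    using w[OF that] by (simp add: v_def causal_input_nonneg)
  \<comment> \<open>Without division, so that a past of total weight 0 imposes nothing on
    \<open>r\<close>.\<close>
  have ex: "\<exists>r. \<forall>x. (\<Sum>j\<in>J. v j xs zs) * pmf r x = (\<Sum>j\<in>J. v j xs zs * pmf (Q j xs zs) x)" for xs zs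
  proof (cases "(\<Sum>j\<in>J. v j xs zs) = 0")
    case True
    hence "\<forall>j\<in>J. v j xs zs = 0"
      using v \<open>finite J\<close> by (simp add: sum_nonneg_eq_0_iff)
    thus ?thesis using True by simp
  next
    case False
    let ?d = "\<Sum>j\<in>J. v j xs zs"
    have d: "0 < ?d" using False sum_nonneg[of J "\<lambda>j. v j xs zs"] v by fastforce
    define f where "f x = (\<Sum>j\<in>J. v j xs zs * pmf (Q j xs zs) x) / ?d" for x
    have f0: "0 \<le> f x" for x
      unfolding f_def using d v by (intro divide_nonneg_pos sum_nonneg) auto
    have "(\<Sum>x\<in>UNIV. f x) = (\<Sum>j\<in>J. v j xs zs * (\<Sum>x\<in>UNIV. pmf (Q j xs zs) x)) / ?d"
      unfolding f_def sum_divide_distrib[symmetric] sum_distrib_left by (subst sum.swap) (rule refl)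
    also have "\<dots> = 1" using False by (simp add: sum_pmf_eq_1)
    finally have "(\<integral>\<^sup>+x. ennreal (f x) \<partial>count_space UNIV) = 1"
      by (simp add: nn_integral_count_space_finite sum_ennreal f0)
    hence "pmf (embed_pmf f) x = f x" for x
      by (intro pmf_embed_pmf f0)
    hence "\<forall>x. ?d * pmf (embed_pmf f) x = (\<Sum>j\<in>J. v j xs zs * pmf (Q j xs zs) x)"
      using False by (simp add: f_def)
    thus ?thesis by blast
  qed
  then obtain R where R:
    "\<And>xs zs x. (\<Sum>j\<in>J. v j xs zs) * pmf (R xs zs) x = (\<Sum>j\<in>J. v j xs zs * pmf (Q j xs zs) x)"
    by metis
  \<comment> \<open>The normalisers of the posteriors telescope along the path.\<close>
  have "sum w J * causal_input R xs zs = (\<Sum>j\<in>J. v j xs zs)" if "length zs = length xs" for xs zs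
    using that
  proof (induction xs arbitrary: zs rule: rev_induct)
    case Nil
    thus ?case by (simp add: v_def)
  next
    case (snoc x xs)
    then obtain zs1 z1 where zs: "zs = zs1 @ [z1]" "length zs1 = length xs"
      by (cases zs rule: rev_cases) auto
    have "sum w J * causal_input R (xs @ [x]) zs = (\<Sum>j\<in>J. v j xs zs1) * pmf (R xs zs1) x"
      unfolding zs snoc.IH[OF zs(2), symmetric] by (simp add: causal_input_snoc zs(2))
    also have "\<dots> = (\<Sum>j\<in>J. v j (xs @ [x]) zs)"
      unfolding R by (simp add: v_def zs causal_input_snoc mult.assoc)
    finally show ?case .
  qed
  thus ?thesis unfolding v_def by blast
qed

text \<open>The law of the outputs and the last state, \<open>P(y^n, s_n = s | x^n, s_0)\<close>; junk for lists of different lengths.\<close>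

fun fwd :: "('x \<Rightarrow> 's::finite \<Rightarrow> ('y \<times> 's) pmf) \<Rightarrow> 's \<Rightarrow> 'x list \<Rightarrow> 'y list \<Rightarrow> 's \<Rightarrow> real" where
  "fwd W s0 (x # xs) (y # ys) s = (\<Sum>s1\<in>UNIV. pmf (W x s0) (y, s1) * fwd W s1 xs ys s)"
| "fwd W s0 _ _ s = (if s = s0 then 1 else 0)"

lemma fwd_nonneg: "0 \<le> fwd W s0 xs ys s"
  by (induction W s0 xs ys s rule: fwd.induct) (auto intro!: sum_nonneg)

lemma sum_blocks_Cons:
  "(\<Sum>xs\<in>blocks (Suc N). f xs) = (\<Sum>x\<in>UNIV. \<Sum>xs\<in>blocks N. f (x # xs :: 'a::finite list))"
proof -
  have "(\<Sum>xs\<in>blocks (Suc N). f xs) = (\<Sum>(x, xs)\<in>UNIV \<times> blocks N. f (x # xs))"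
    by (rule sum.reindex_bij_witness[of _ "\<lambda>(x, xs). x # xs" "\<lambda>xs. (hd xs, tl xs)"])
      (auto simp: blocks_def length_Suc_conv)
  thus ?thesis by (simp add: sum.cartesian_product)
qed

lemma chan_from_Cons:
  "chan_from W s0 (x # xs) (y # ys) = (\<Sum>s\<in>UNIV. pmf (W x s0) (y, s) * chan_from W s xs ys)"
  by (simp add: chan_from_def sum_blocks_Cons prod.lessThan_Suc_shift sum_distrib_left del: prod.lessThan_Suc)

text \<open>The Markov property at the state between the two blocks. Like the recursion of
  \<open>fwd\<close>, the induction peels off first letters and thereby changes the initial
  state.\<close>

lemma chan_from_append:
  assumes "length ys = length xs"
  shows "chan_from W s0 (xs @ xs') (ys @ ys') = (\<Sum>s\<in>UNIV. fwd W s0 xs ys s * chan_from W s xs' ys')"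
  using assms
proof (induction ys xs arbitrary: s0 rule: list_induct2)
  case Nil
  show ?case by (simp add: of_bool_def if_distrib[of "\<lambda>x. x * _"] cong: if_cong)
next
  case (Cons y ys x xs)
  have "chan_from W s0 ((x # xs) @ xs') ((y # ys) @ ys') =
    (\<Sum>s1\<in>UNIV. \<Sum>s\<in>UNIV. pmf (W x s0) (y, s1) * fwd W s1 xs ys s * chan_from W s xs' ys')"
    by (simp add: chan_from_Cons Cons.IH sum_distrib_left mult_ac)
  also have "\<dots> = (\<Sum>s\<in>UNIV. fwd W s0 (x # xs) (y # ys) s * chan_from W s xs' ys')"
    by (subst sum.swap) (simp add: sum_distrib_right)
  finally show ?case .
qed

definition fwd_mass :: "('x \<Rightarrow> 's::finite \<Rightarrow> ('y \<times> 's) pmf) \<Rightarrow> 's pmf \<Rightarrow> 'x list \<Rightarrow> 'y list \<Rightarrow> 's \<Rightarrow> real" where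
  "fwd_mass W P0 xs ys s = (\<Sum>s0\<in>UNIV. pmf P0 s0 * fwd W s0 xs ys s)"

lemma fwd_mass_nonneg: "0 \<le> fwd_mass W P0 xs ys s"
  by (simp add: fwd_mass_def sum_nonneg fwd_nonneg)

lemma chan_from_Nil [simp]: "chan_from W s0 [] [] = 1"
  by (simp add: chan_from_def blocks_0)

lemma chan_append:
  assumes "length ys = length xs"
  shows "chan W P0 (xs @ xs') (ys @ ys') = (\<Sum>s\<in>UNIV. fwd_mass W P0 xs ys s * chan_from W s xs' ys')"
proof -
  have "chan W P0 (xs @ xs') (ys @ ys') =
    (\<Sum>s0\<in>UNIV. \<Sum>s\<in>UNIV. pmf P0 s0 * fwd W s0 xs ys s * chan_from W s xs' ys')"
    using assms by (simp add: chan_def chan_from_append sum_distrib_left mult_ac)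
  also have "\<dots> = (\<Sum>s\<in>UNIV. fwd_mass W P0 xs ys s * chan_from W s xs' ys')"
    by (subst sum.swap) (simp add: fwd_mass_def sum_distrib_right)
  finally show ?thesis .
qed

lemma chan_eq_sum_fwd_mass:
  "length ys = length xs \<Longrightarrow> chan W P0 xs ys = (\<Sum>s\<in>UNIV. fwd_mass W P0 xs ys s)"
  using chan_append[of ys xs W P0 "[]" "[]"] by simp

lemma chan_nonneg: "0 \<le> chan W P0 xs ys"
  by (simp add: chan_def sum_nonneg chan_from_nonneg)

lemma chan_return: "chan W (return_pmf s) = chan_from W s"
  by (intro ext) (simp add: chan_def indicator_def of_bool_def if_distrib[of "\<lambda>x. x * _"] cong: if_cong)

lemma fwd_mass_mult_le_chan:
  assumes "length ys = length xs"
  shows "fwd_mass W P0 xs ys s * chan_from W s xs' ys' \<le> chan W P0 (xs @ xs') (ys @ ys')"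
  unfolding chan_append[OF assms]
  by (rule member_le_sum) (auto intro: mult_nonneg_nonneg fwd_mass_nonneg chan_from_nonneg)

lemma fwd_mass_le_chan: "length ys = length xs \<Longrightarrow> fwd_mass W P0 xs ys s \<le> chan W P0 xs ys"
  using fwd_mass_mult_le_chan[of ys xs W P0 s "[]" "[]"] by simp

lemma sum_chan_from:
  fixes W :: "'x \<Rightarrow> 's::finite \<Rightarrow> ('y::finite \<times> 's) pmf"
  shows "(\<Sum>ys\<in>blocks (length xs). chan_from W s0 xs ys) = 1"
proof (induction xs rule: rev_induct)
  case Nil
  show ?case by (simp add: blocks_0)
next
  case (snoc x xs)
  have "(\<Sum>ys\<in>blocks (length (xs @ [x])). chan_from W s0 (xs @ [x]) ys) =
    (\<Sum>ys\<in>blocks (length xs). chan_from W s0 xs ys)"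
    unfolding length_append list.size add_0_right add_Suc_right sum_blocks_Suc
    by (intro sum.cong refl sum_chan_from_snoc) (simp add: blocks_def)
  thus ?case using snoc.IH by simp
qed

lemma chan_from_le_1:
  fixes W :: "'x \<Rightarrow> 's::finite \<Rightarrow> ('y::finite \<times> 's) pmf"
  assumes "length ys = length xs"
  shows "chan_from W s0 xs ys \<le> 1"
proof -
  have "ys \<in> blocks (length xs)" using assms by (simp add: blocks_def)
  thus ?thesis
    using member_le_sum[of ys "blocks (length xs)" "chan_from W s0 xs"]
    by (simp add: chan_from_nonneg sum_chan_from)
qed

lemma sum_chan:
  fixes W :: "'x \<Rightarrow> 's::finite \<Rightarrow> ('y::finite \<times> 's) pmf"
  assumes "xs \<in> blocks N"
  shows "(\<Sum>ys\<in>blocks N. chan W P0 xs ys) = 1"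
  unfolding chan_def using assms sum_chan_from[of W _ xs]
  by (subst sum.swap) (simp add: blocks_def sum_pmf_eq_1 flip: sum_distrib_left)

section \<open>Directed information as an expected log-likelihood ratio\<close>

text \<open>Agrees with \<open>joint_mass\<close> on blocks of length N, as the last feedback symbol
  is never read. Without the truncation at N - 1 the formula is the same for every horizon and
  compatible with concatenation.\<close>

definition path_mass ::
  "('x \<Rightarrow> 's::finite \<Rightarrow> ('y \<times> 's) pmf) \<Rightarrow> 's pmf \<Rightarrow> ('y \<Rightarrow> 'z) \<Rightarrow> ('x, 'z) input_policy
     \<Rightarrow> 'x list \<Rightarrow> 'y list \<Rightarrow> real" where
  "path_mass W P0 z Q xs ys = causal_input Q xs (map z ys) * chan W P0 xs ys"

definition out_mass ::
  "('x \<Rightarrow> 's::finite \<Rightarrow> ('y \<times> 's) pmf) \<Rightarrow> 's pmf \<Rightarrow> ('y \<Rightarrow> 'z) \<Rightarrow> ('x, 'z) input_policy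
     \<Rightarrow> 'y list \<Rightarrow> real" where
  "out_mass W P0 z Q ys = (\<Sum>xs\<in>blocks (length ys). path_mass W P0 z Q xs ys)"

abbreviation later_policy :: "('x, 'z) input_policy \<Rightarrow> 'x list \<Rightarrow> 'z list \<Rightarrow> ('x, 'z) input_policy" where
  "later_policy Q xs zs \<equiv> (\<lambda>a b. Q (xs @ a) (zs @ b))"

lemma path_mass_nonneg: "0 \<le> path_mass W P0 z Q xs ys"
  by (simp add: path_mass_def causal_input_nonneg chan_nonneg)

lemma out_mass_nonneg: "0 \<le> out_mass W P0 z Q ys"
  by (simp add: out_mass_def sum_nonneg path_mass_nonneg)

lemma path_mass_le_out_mass:
  fixes W :: "'x::finite \<Rightarrow> 's::finite \<Rightarrow> ('y \<times> 's) pmf"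
  assumes "length ys = length xs"
  shows "path_mass W P0 z Q xs ys \<le> out_mass W P0 z Q ys"
  unfolding out_mass_def using assms
  by (intro member_le_sum) (simp_all add: path_mass_nonneg, simp add: blocks_def)

lemma path_mass_pos:
  fixes W :: "'x::finite \<Rightarrow> 's::finite \<Rightarrow> ('y \<times> 's) pmf"
  assumes "0 < path_mass W P0 z Q xs ys" "length ys = length xs"
  shows "0 < causal_input Q xs (map z ys)" "0 < chan W P0 xs ys" "0 < out_mass W P0 z Q ys"
proof -
  have "causal_input Q xs (map z ys) \<noteq> 0" "chan W P0 xs ys \<noteq> 0"
    using assms(1) by (auto simp: path_mass_def)
  thus "0 < causal_input Q xs (map z ys)" "0 < chan W P0 xs ys"
    using causal_input_nonneg[of Q xs "map z ys"] chan_nonneg[of W P0 xs ys] by linarith+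
  show "0 < out_mass W P0 z Q ys"
    using assms path_mass_le_out_mass less_le_trans by metis
qed

lemma take_in_blocks: "xs \<in> blocks N \<Longrightarrow> j \<le> N \<Longrightarrow> take j xs \<in> blocks j"
  by (simp add: blocks_def)

lemma path_mass_append:
  assumes "length ys = length xs"
  shows "path_mass W P0 z Q (xs @ xs') (ys @ ys') =
    (\<Sum>s\<in>UNIV. causal_input Q xs (map z ys) * fwd_mass W P0 xs ys s *
       (causal_input (later_policy Q xs (map z ys)) xs' (map z ys') * chan_from W s xs' ys'))"
  using assms
  by (simp add: path_mass_def chan_append causal_input_append sum_distrib_left sum_distrib_right mult_ac)

text \<open>Consistency in the horizon: given the prefix and the state it ends in, the continuation
  has total mass 1 by \<open>sum_joint_from\<close>. Hence prefixes of long paths obey the law of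
  the short problem.\<close>

lemma sum_path_mass_append:
  fixes W :: "'x::finite \<Rightarrow> 's::finite \<Rightarrow> ('y::finite \<times> 's) pmf"
  assumes "length ys = length xs"
  shows "(\<Sum>xs'\<in>blocks T. \<Sum>ys'\<in>blocks T. path_mass W P0 z Q (xs @ xs') (ys @ ys')) =
    path_mass W P0 z Q xs ys"
proof -
  let ?R = "later_policy Q xs (map z ys)"
  have "(\<Sum>xs'\<in>blocks T. \<Sum>ys'\<in>blocks T. path_mass W P0 z Q (xs @ xs') (ys @ ys')) =
    (\<Sum>xs'\<in>blocks T. \<Sum>s\<in>UNIV. \<Sum>ys'\<in>blocks T. causal_input Q xs (map z ys) * fwd_mass W P0 xs ys s *
       (causal_input ?R xs' (map z ys') * chan_from W s xs' ys'))"
    unfolding path_mass_append[OF assms] by (intro sum.cong refl sum.swap)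
  also have "\<dots> = (\<Sum>s\<in>UNIV. causal_input Q xs (map z ys) * fwd_mass W P0 xs ys s *
      (\<Sum>xs'\<in>blocks T. \<Sum>ys'\<in>blocks T. causal_input ?R xs' (map z ys') * chan_from W s xs' ys'))"
    by (subst sum.swap) (simp only: sum_distrib_left)
  also have "\<dots> = path_mass W P0 z Q xs ys"
    by (simp add: sum_joint_from path_mass_def chan_eq_sum_fwd_mass[OF assms] sum_distrib_left)
  finally show ?thesis .
qed

lemma chan_Nil [simp]: "chan W P0 [] [] = 1"
  by (simp add: chan_def sum_pmf_eq_1)

lemma path_mass_Nil [simp]: "path_mass W P0 z Q [] [] = 1"
  by (simp add: path_mass_def)

lemma out_mass_Nil [simp]: "out_mass W P0 z Q [] = 1"
  by (simp add: out_mass_def blocks_0)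

lemma sum_path_mass:
  fixes W :: "'x::finite \<Rightarrow> 's::finite \<Rightarrow> ('y::finite \<times> 's) pmf"
  shows "(\<Sum>xs\<in>blocks N. \<Sum>ys\<in>blocks N. path_mass W P0 z Q xs ys) = 1"
  using sum_path_mass_append[of "[]" "[]" W P0 z Q N] by simp

lemma sum_out_mass:
  fixes W :: "'x::finite \<Rightarrow> 's::finite \<Rightarrow> ('y::finite \<times> 's) pmf"
  shows "(\<Sum>ys\<in>blocks N. out_mass W P0 z Q ys) = 1"
proof -
  have "(\<Sum>ys\<in>blocks N. out_mass W P0 z Q ys) =
    (\<Sum>ys\<in>blocks N. \<Sum>xs\<in>blocks N. path_mass W P0 z Q xs ys)"
    by (intro sum.cong refl) (simp add: out_mass_def blocks_def)
  also have "\<dots> = 1"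
    by (subst sum.swap) (rule sum_path_mass)
  finally show ?thesis .
qed

lemma out_mass_le_1:
  fixes W :: "'x::finite \<Rightarrow> 's::finite \<Rightarrow> ('y::finite \<times> 's) pmf"
  shows "out_mass W P0 z Q ys \<le> 1"
proof -
  have "ys \<in> blocks (length ys)" by (simp add: blocks_def)
  thus ?thesis
    using member_le_sum[of ys "blocks (length ys)" "out_mass W P0 z Q"]
    by (simp add: out_mass_nonneg sum_out_mass)
qed

section \<open>Probabilities and expectations under a law of finite support\<close>

lemma prob_eq_sum:
  assumes "finite B" "set_pmf p \<subseteq> B"
  shows "measure_pmf.prob p {w. P w} = (\<Sum>w | w \<in> B \<and> P w. pmf p w)"
proof -
  have "{w. P w} \<inter> set_pmf p = {w. w \<in> B \<and> P w} \<inter> set_pmf p" using assms(2) by auto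
  hence "measure_pmf.prob p {w. P w} = measure_pmf.prob p {w. w \<in> B \<and> P w}"
    by (metis measure_Int_set_pmf)
  also have "\<dots> = (\<Sum>w | w \<in> B \<and> P w. pmf p w)"
    using assms(1) by (intro measure_measure_pmf_finite) auto
  finally show ?thesis .
qed

lemma prob_cong_support:
  assumes "\<And>w. w \<in> set_pmf p \<Longrightarrow> P w \<longleftrightarrow> P' w"
  shows "measure_pmf.prob p {w. P w} = measure_pmf.prob p {w. P' w}"
proof -
  have "{w. P w} \<inter> set_pmf p = {w. P' w} \<inter> set_pmf p" using assms by auto
  thus ?thesis by (metis measure_Int_set_pmf)
qed

lemma prob_split:
  assumes "finite B" "set_pmf p \<subseteq> B" "finite T" "\<And>w. w \<in> B \<Longrightarrow> P w \<Longrightarrow> h w \<in> T"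
  shows "measure_pmf.prob p {w. P w} = (\<Sum>t\<in>T. measure_pmf.prob p {w. P w \<and> h w = t})"
proof -
  have "(\<Sum>t\<in>T. measure_pmf.prob p {w. P w \<and> h w = t}) =
    (\<Sum>t\<in>T. \<Sum>w | w \<in> {w \<in> B. P w} \<and> h w = t. pmf p w)"
    unfolding prob_eq_sum[OF assms(1,2)] by (intro sum.cong) auto
  also have "\<dots> = (\<Sum>w | w \<in> B \<and> P w. pmf p w)"
    using assms by (intro sum.group) auto
  finally show ?thesis by (simp add: prob_eq_sum[OF assms(1,2)])
qed

lemma sum_prob_fibre:
  assumes "finite B" "set_pmf p \<subseteq> B" "finite (range V)"
  shows "(\<Sum>t\<in>range V. measure_pmf.prob p {w. V w = t} * F t) = (\<Sum>w\<in>B. pmf p w * F (V w))"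
proof -
  have "(\<Sum>t\<in>range V. measure_pmf.prob p {w. V w = t} * F t) =
    (\<Sum>t\<in>range V. \<Sum>w | w \<in> B \<and> V w = t. pmf p w * F (V w))"
    unfolding prob_eq_sum[OF assms(1,2)] sum_distrib_right by (intro sum.cong refl) auto
  also have "\<dots> = (\<Sum>w\<in>B. pmf p w * F (V w))"
    using assms by (intro sum.group) auto
  finally show ?thesis .
qed

section \<open>Marginals of the joint law and its information density\<close>

context
  fixes W :: "'x::finite \<Rightarrow> 's::finite \<Rightarrow> ('y::finite \<times> 's) pmf"
    and P0 :: "'s pmf" and z :: "'y \<Rightarrow> 'z" and Q :: "('x, 'z) input_policy" and N :: nat
begin

private abbreviation (input) "p \<equiv> joint_law W P0 z N Q"
private abbreviation (input) "B \<equiv> blocks N \<times> blocks N"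

lemma pmf_joint_law_eq:
  "pmf p (xs, ys) = (if xs \<in> blocks N \<and> ys \<in> blocks N then path_mass W P0 z Q xs ys else 0)"
  by (simp add: pmf_joint_law joint_mass_def path_mass_def causal_input_take[simplified])

lemma set_pmf_joint_law: "set_pmf p \<subseteq> B"
  by (auto simp: set_pmf_eq pmf_joint_law_eq split: if_splits)

lemma prob_joint_law_take:
  assumes "j \<le> N" "a \<in> blocks j" "b \<in> blocks j"
  shows "measure_pmf.prob p {w. take j (fst w) = a \<and> take j (snd w) = b} = path_mass W P0 z Q a b"
proof -
  have "measure_pmf.prob p {w. take j (fst w) = a \<and> take j (snd w) = b} =
    (\<Sum>w | w \<in> B \<and> take j (fst w) = a \<and> take j (snd w) = b. pmf p w)"
    by (rule prob_eq_sum) (use set_pmf_joint_law in auto)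
  also have "\<dots> = (\<Sum>(xs, ys)\<in>blocks (N - j) \<times> blocks (N - j). path_mass W P0 z Q (a @ xs) (b @ ys))"
  proof (rule sum.reindex_bij_witness[of _ "\<lambda>(xs, ys). (a @ xs, b @ ys)" "\<lambda>(xs, ys). (drop j xs, drop j ys)"])
    fix w assume w: "w \<in> {w \<in> B. take j (fst w) = a \<and> take j (snd w) = b}"
    obtain xs ys where xy: "w = (xs, ys)" by fastforce
    have "a @ drop j xs = xs" "b @ drop j ys = ys"
      using w append_take_drop_id[of j xs] append_take_drop_id[of j ys] by (auto simp: xy)
    with w show "(case case w of (xs, ys) \<Rightarrow> (drop j xs, drop j ys) of (xs, ys) \<Rightarrow> (a @ xs, b @ ys)) = w"
      "(case case w of (xs, ys) \<Rightarrow> (drop j xs, drop j ys) of (xs, ys) \<Rightarrow> path_mass W P0 z Q (a @ xs) (b @ ys)) = pmf p w"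
      by (auto simp: xy pmf_joint_law_eq)
  qed (use assms in \<open>auto simp: blocks_def\<close>)
  also have "\<dots> = path_mass W P0 z Q a b"
    using assms by (simp add: sum.cartesian_product' sum_path_mass_append blocks_def[of j])
  finally show ?thesis .
qed

lemma prob_joint_law_out:
  assumes "j \<le> N" "b \<in> blocks j"
  shows "measure_pmf.prob p {w. take j (snd w) = b} = out_mass W P0 z Q b"
proof -
  have "measure_pmf.prob p {w. take j (snd w) = b} =
    (\<Sum>a\<in>blocks j. measure_pmf.prob p {w. take j (snd w) = b \<and> take j (fst w) = a})"
    by (rule prob_split[of B]) (use set_pmf_joint_law assms in \<open>auto intro: take_in_blocks\<close>)
  also have "\<dots> = (\<Sum>a\<in>blocks j. path_mass W P0 z Q a b)"
    using prob_joint_law_take[OF assms(1) _ assms(2)] by (intro sum.cong refl) (simp add: conj_commute)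
  also have "\<dots> = out_mass W P0 z Q b"
    using assms by (simp add: out_mass_def blocks_def)
  finally show ?thesis .
qed

lemma sum_chan_snoc:
  assumes "length ys = length xs"
  shows "(\<Sum>y\<in>UNIV. chan W P0 (xs @ [x]) (ys @ [y])) = chan W P0 xs ys"
  unfolding chan_def using sum_chan_from_snoc[OF assms, of W _ x]
  by (subst sum.swap) (simp flip: sum_distrib_left)

text \<open>Summing out the output that answers \<open>x\<close> leaves the channel factor of the
  steps before. The \<open>y\<close> on the right is arbitrary: it only pads the feedback by a
  symbol that \<open>causal_input\<close> does not read.\<close>

lemma prob_joint_law_input:
  assumes "i < N" "a \<in> blocks i" "b \<in> blocks i"
  shows "measure_pmf.prob p {w. take (Suc i) (fst w) = a @ [x] \<and> take i (snd w) = b} =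
    causal_input Q (a @ [x]) (map z (b @ [y])) * chan W P0 a b"
proof -
  have len: "length b = length a" using assms by (simp add: blocks_def)
  have "measure_pmf.prob p {w. take (Suc i) (fst w) = a @ [x] \<and> take i (snd w) = b} =
    (\<Sum>y\<in>UNIV. measure_pmf.prob p {w. (take (Suc i) (fst w) = a @ [x] \<and> take i (snd w) = b) \<and> snd w ! i = y})"
    by (rule prob_split[of B]) (use set_pmf_joint_law in auto)
  also have "\<dots> = (\<Sum>y\<in>UNIV. measure_pmf.prob p {w. take (Suc i) (fst w) = a @ [x] \<and> take (Suc i) (snd w) = b @ [y]})"
    using set_pmf_joint_law assms
    by (intro sum.cong refl prob_cong_support) (auto simp: blocks_def take_Suc_conv_app_nth)
  also have "\<dots> = (\<Sum>y\<in>UNIV. path_mass W P0 z Q (a @ [x]) (b @ [y]))"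
    using assms by (intro sum.cong refl prob_joint_law_take) (auto simp: blocks_def)
  also have "\<dots> = causal_input Q (a @ [x]) (map z (b @ [y])) * chan W P0 a b"
    using sum_chan_snoc[OF len, of x]
    by (simp add: path_mass_def causal_input_snoc len flip: sum_distrib_left)
  finally show ?thesis .
qed

text \<open>The conditional information density is a ratio of four masses of prefixes in which the
  policy factors cancel. What remains is a difference of consecutive values of one function of the
  prefix, ready to telescope.\<close>

lemma cond_mi_joint_law:
  assumes "i < N"
  shows "cond_mi p (\<lambda>(xs, ys). take (Suc i) xs) (\<lambda>(xs, ys). ys ! i) (\<lambda>(xs, ys). take i ys) =
    (\<Sum>(xs, ys)\<in>B. path_mass W P0 z Q xs ys *
       (log 2 (chan W P0 (take (Suc i) xs) (take (Suc i) ys) / out_mass W P0 z Q (take (Suc i) ys)) -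
        log 2 (chan W P0 (take i xs) (take i ys) / out_mass W P0 z Q (take i ys))))"
proof -
  let ?X = "\<lambda>(xs :: 'x list, ys :: 'y list). take (Suc i) xs"
  let ?Y = "\<lambda>(xs :: 'x list, ys :: 'y list). ys ! i"
  let ?Z = "\<lambda>(xs :: 'x list, ys :: 'y list). take i ys"
  let ?P = "\<lambda>E. measure_pmf.prob p {w. E w}"
  let ?V = "\<lambda>w. (?X w, ?Y w, ?Z w)"
  have fin: "finite (range ?X)" "finite (range ?Y)" "finite (range ?Z)"
    using finite_range_take by (auto intro: finite_subset)
  have finV: "finite (range ?V)"
    by (rule finite_subset[of _ "range ?X \<times> range ?Y \<times> range ?Z"]) (use fin in blast)+
  define F where "F t = (case t of (x, y, c) \<Rightarrow> log 2 (?P (\<lambda>w. ?X w = x \<and> ?Y w = y \<and> ?Z w = c) /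
    (?P (\<lambda>w. ?X w = x \<and> ?Z w = c) * (?P (\<lambda>w. ?Y w = y \<and> ?Z w = c) / ?P (\<lambda>w. ?Z w = c)))))" for t
  have "cond_mi p ?X ?Y ?Z = (\<Sum>t\<in>range ?V. ?P (\<lambda>w. ?V w = t) * F t)"
    unfolding cond_mi_eq[OF fin] F_def by (intro sum.cong refl) auto
  \<comment> \<open>The sum over values of the triple becomes an expectation over whole paths, so
    that all times i share one index set.\<close>
  also have "\<dots> = (\<Sum>w\<in>B. pmf p w * F (?V w))"
    by (rule sum_prob_fibre) (use set_pmf_joint_law finV in auto)
  also have "\<dots> = (\<Sum>(xs, ys)\<in>B. path_mass W P0 z Q xs ys *
       (log 2 (chan W P0 (take (Suc i) xs) (take (Suc i) ys) / out_mass W P0 z Q (take (Suc i) ys)) -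
        log 2 (chan W P0 (take i xs) (take i ys) / out_mass W P0 z Q (take i ys))))"
  proof -
    have "pmf p (xs, ys) * F (?V (xs, ys)) = path_mass W P0 z Q xs ys *
       (log 2 (chan W P0 (take (Suc i) xs) (take (Suc i) ys) / out_mass W P0 z Q (take (Suc i) ys)) -
        log 2 (chan W P0 (take i xs) (take i ys) / out_mass W P0 z Q (take i ys)))"
      if xs: "xs \<in> blocks N" and ys: "ys \<in> blocks N" for xs :: "'x list" and ys :: "'y list"
    proof -
    let ?x = "take (Suc i) xs" and ?y = "take (Suc i) ys" and ?xp = "take i xs" and ?yp = "take i ys"
    have x: "?x = ?xp @ [xs ! i]" "?x \<in> blocks (Suc i)" "?xp \<in> blocks i"
      using take_Suc_conv_app_nth[of i xs] take_in_blocks[OF xs, of i] take_in_blocks[OF xs, of "Suc i"] xs assms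
      by (auto simp: blocks_def[of N])
    have y: "?y = ?yp @ [ys ! i]" "?y \<in> blocks (Suc i)" "?yp \<in> blocks i"
      using take_Suc_conv_app_nth[of i ys] take_in_blocks[OF ys, of i] take_in_blocks[OF ys, of "Suc i"] ys assms
      by (auto simp: blocks_def[of N])
    \<comment> \<open>Off the support a list may be too short for \<open>ys ! i\<close> to be its
      next letter, so events are compared on the support only.\<close>
    have sup: "length ys' = N" if "(xs', ys') \<in> set_pmf p" for xs' ys'
      using that set_pmf_joint_law by (auto simp: blocks_def)
    have P1: "?P (\<lambda>w. ?X w = ?x \<and> ?Y w = ys ! i \<and> ?Z w = ?yp) = path_mass W P0 z Q ?x ?y"
    proof -
      have "?P (\<lambda>w. ?X w = ?x \<and> ?Y w = ys ! i \<and> ?Z w = ?yp) =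
        ?P (\<lambda>w. take (Suc i) (fst w) = ?x \<and> take (Suc i) (snd w) = ?y)"
        using sup assms unfolding y(1)
        by (intro prob_cong_support) (auto simp: take_Suc_conv_app_nth)
      thus ?thesis using assms by (simp only: prob_joint_law_take[OF _ x(2) y(2)] Suc_leI)
    qed
    have P2: "?P (\<lambda>w. ?X w = ?x \<and> ?Z w = ?yp) =
      causal_input Q ?x (map z ?y) * chan W P0 ?xp ?yp"
      using prob_joint_law_input[OF assms x(3) y(3), of "xs ! i" "ys ! i"] unfolding x(1) y(1)
      by (simp add: case_prod_beta)
    have P3: "?P (\<lambda>w. ?Y w = ys ! i \<and> ?Z w = ?yp) = out_mass W P0 z Q ?y"
    proof -
      have "?P (\<lambda>w. ?Y w = ys ! i \<and> ?Z w = ?yp) = ?P (\<lambda>w. take (Suc i) (snd w) = ?y)"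
        using sup assms unfolding y(1)
        by (intro prob_cong_support) (auto simp: take_Suc_conv_app_nth)
      thus ?thesis using assms by (simp only: prob_joint_law_out[OF _ y(2)] Suc_leI)
    qed
    have P4: "?P (\<lambda>w. ?Z w = ?yp) = out_mass W P0 z Q ?yp"
      using prob_joint_law_out[OF _ y(3)] assms by (simp add: case_prod_beta)
    have F: "F (?V (xs, ys)) = log 2 (path_mass W P0 z Q ?x ?y /
      (causal_input Q ?x (map z ?y) * chan W P0 ?xp ?yp * (out_mass W P0 z Q ?y / out_mass W P0 z Q ?yp)))"
      unfolding F_def prod.case P1 P2 P3 P4 ..
    show "pmf p (xs, ys) * F (?V (xs, ys)) = path_mass W P0 z Q xs ys *
       (log 2 (chan W P0 ?x ?y / out_mass W P0 z Q ?y) - log 2 (chan W P0 ?xp ?yp / out_mass W P0 z Q ?yp))"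
    proof (cases "path_mass W P0 z Q xs ys = 0")
      case True
      thus ?thesis by (simp add: pmf_joint_law_eq)
    next
      case False
      hence pos: "0 < pmf p (xs, ys)" using path_mass_nonneg[of W P0 z Q xs ys] xs ys
        by (simp add: pmf_joint_law_eq)
      \<comment> \<open>A prefix event contains the path and so has at least its mass; all
        logarithms below get positive arguments.\<close>
      have m: "0 < path_mass W P0 z Q (take j xs) (take j ys)" if "j \<le> N" for j
      proof -
        have "pmf p (xs, ys) = measure_pmf.prob p {(xs, ys)}" by (simp add: pmf.rep_eq)
        also have "\<dots> \<le> ?P (\<lambda>w. take j (fst w) = take j xs \<and> take j (snd w) = take j ys)"
          by (intro measure_pmf.finite_measure_mono) auto
        also have "\<dots> = path_mass W P0 z Q (take j xs) (take j ys)"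
          using that xs ys by (intro prob_joint_law_take) (auto simp: blocks_def)
        finally show ?thesis using pos by simp
      qed
      have "0 < causal_input Q (take j xs) (map z (take j ys)) \<and> 0 < chan W P0 (take j xs) (take j ys) \<and>
        0 < out_mass W P0 z Q (take j ys)" if "j \<le> N" for j
        using path_mass_pos[OF m[OF that]] xs ys by (simp add: blocks_def)
      note this[of i] this[of "Suc i"]
      hence "F (?V (xs, ys)) =
        log 2 (chan W P0 ?x ?y / out_mass W P0 z Q ?y) - log 2 (chan W P0 ?xp ?yp / out_mass W P0 z Q ?yp)"
        unfolding F path_mass_def using assms by (auto simp add: log_divide log_mult)
      thus ?thesis using xs ys by (simp add: pmf_joint_law_eq)
    qed
    qed
    thus ?thesis by (intro sum.cong refl) auto
  qed
  finally show ?thesis .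
qed

text \<open>Telescoping of \<open>cond_mi_joint_law\<close>; the term at length 0 is log 1, as both
  masses of the empty path are 1.\<close>

lemma directed_info_joint_law:
  "directed_info N p = (\<Sum>xs\<in>blocks N. \<Sum>ys\<in>blocks N.
     path_mass W P0 z Q xs ys * log 2 (chan W P0 xs ys / out_mass W P0 z Q ys))"
proof -
  let ?l = "\<lambda>xs ys i. log 2 (chan W P0 (take i xs) (take i ys) / out_mass W P0 z Q (take i ys))"
  have "directed_info N p =
    (\<Sum>i<N. \<Sum>w\<in>B. case w of (xs, ys) \<Rightarrow> path_mass W P0 z Q xs ys * (?l xs ys (Suc i) - ?l xs ys i))"
    unfolding directed_info_def by (intro sum.cong refl cond_mi_joint_law) auto
  also have "\<dots> = (\<Sum>w\<in>B. case w of (xs, ys) \<Rightarrow> path_mass W P0 z Q xs ys * (\<Sum>i<N. ?l xs ys (Suc i) - ?l xs ys i))"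
    by (subst sum.swap) (simp add: case_prod_beta sum_distrib_left)
  also have "\<dots> = (\<Sum>w\<in>B. case w of (xs, ys) \<Rightarrow> path_mass W P0 z Q xs ys * log 2 (chan W P0 xs ys / out_mass W P0 z Q ys))"
  proof (intro sum.cong refl, clarify)
    fix xs :: "'x list" and ys :: "'y list" assume "xs \<in> blocks N" "ys \<in> blocks N"
    thus "path_mass W P0 z Q xs ys * (\<Sum>i<N. ?l xs ys (Suc i) - ?l xs ys i) =
      path_mass W P0 z Q xs ys * log 2 (chan W P0 xs ys / out_mass W P0 z Q ys)"
      using sum_lessThan_telescope[of "?l xs ys" N] by (simp add: blocks_def)
  qed
  finally show ?thesis by (simp add: sum.cartesian_product)
qed

end

section \<open>Splitting directed information in time\<close>

lemma sum_mult_log_nonneg2: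
  fixes p q f :: "'i \<Rightarrow> 'j \<Rightarrow> real"
  assumes "\<And>x y. x \<in> A \<Longrightarrow> y \<in> B \<Longrightarrow> 0 \<le> p x y" "\<And>x y. x \<in> A \<Longrightarrow> y \<in> B \<Longrightarrow> 0 \<le> q x y"
    and "\<And>x y. x \<in> A \<Longrightarrow> y \<in> B \<Longrightarrow> 0 < p x y \<Longrightarrow> 0 < q x y \<and> log 2 (p x y / q x y) \<le> f x y"
    and "(\<Sum>x\<in>A. \<Sum>y\<in>B. q x y) \<le> (\<Sum>x\<in>A. \<Sum>y\<in>B. p x y)"
  shows "0 \<le> (\<Sum>x\<in>A. \<Sum>y\<in>B. p x y * f x y)"
  using sum_mult_log_nonneg[of "A \<times> B" "\<lambda>(x, y). p x y" "\<lambda>(x, y). q x y" "\<lambda>(x, y). f x y"] assms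
  by (auto simp: sum.cartesian_product')

lemma sum_mult_log_nonneg5:
  fixes p q f :: "'i \<Rightarrow> 'j \<Rightarrow> 'k \<Rightarrow> 'l \<Rightarrow> 'm \<Rightarrow> real"
  assumes "\<And>a b c d e. a \<in> A \<Longrightarrow> b \<in> B \<Longrightarrow> c \<in> C \<Longrightarrow> d \<in> D \<Longrightarrow> e \<in> E \<Longrightarrow> 0 \<le> p a b c d e"
    and "\<And>a b c d e. a \<in> A \<Longrightarrow> b \<in> B \<Longrightarrow> c \<in> C \<Longrightarrow> d \<in> D \<Longrightarrow> e \<in> E \<Longrightarrow> 0 \<le> q a b c d e"
    and "\<And>a b c d e. a \<in> A \<Longrightarrow> b \<in> B \<Longrightarrow> c \<in> C \<Longrightarrow> d \<in> D \<Longrightarrow> e \<in> E \<Longrightarrow> 0 < p a b c d e \<Longrightarrow>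
      0 < q a b c d e \<and> log 2 (p a b c d e / q a b c d e) \<le> f a b c d e"
    and "(\<Sum>a\<in>A. \<Sum>b\<in>B. \<Sum>c\<in>C. \<Sum>d\<in>D. \<Sum>e\<in>E. q a b c d e) \<le>
      (\<Sum>a\<in>A. \<Sum>b\<in>B. \<Sum>c\<in>C. \<Sum>d\<in>D. \<Sum>e\<in>E. p a b c d e)"
  shows "0 \<le> (\<Sum>a\<in>A. \<Sum>b\<in>B. \<Sum>c\<in>C. \<Sum>d\<in>D. \<Sum>e\<in>E. p a b c d e * f a b c d e)"
  using sum_mult_log_nonneg[of "A \<times> B \<times> C \<times> D \<times> E" "\<lambda>(a, b, c, d, e). p a b c d e"
      "\<lambda>(a, b, c, d, e). q a b c d e" "\<lambda>(a, b, c, d, e). f a b c d e"] assms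
  by (auto simp: sum.cartesian_product')

text \<open>Brings the past and the intermediate state outside and the continuation inside.\<close>

lemma sum_reorder5:
  "(\<Sum>a\<in>A. \<Sum>b\<in>B. \<Sum>c\<in>C. \<Sum>d\<in>D. \<Sum>e\<in>E. f a b c d e) =
   (\<Sum>a\<in>A. \<Sum>c\<in>C. \<Sum>e\<in>E. \<Sum>b\<in>B. \<Sum>d\<in>D. f a b c d e)"
proof (rule sum.cong[OF refl])
  fix a
  have "(\<Sum>b\<in>B. \<Sum>c\<in>C. \<Sum>d\<in>D. \<Sum>e\<in>E. f a b c d e) =
    (\<Sum>c\<in>C. \<Sum>b\<in>B. \<Sum>e\<in>E. \<Sum>d\<in>D. f a b c d e)"
    by (subst sum.swap) (intro sum.cong refl sum.swap)
  also have "\<dots> = (\<Sum>c\<in>C. \<Sum>e\<in>E. \<Sum>b\<in>B. \<Sum>d\<in>D. f a b c d e)"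
    by (intro sum.cong refl sum.swap)
  finally show "(\<Sum>b\<in>B. \<Sum>c\<in>C. \<Sum>d\<in>D. \<Sum>e\<in>E. f a b c d e) =
    (\<Sum>c\<in>C. \<Sum>e\<in>E. \<Sum>b\<in>B. \<Sum>d\<in>D. f a b c d e)" .
qed

lemma sum_swap_pairs:
  "(\<Sum>a\<in>A. \<Sum>b\<in>B. \<Sum>c\<in>C. \<Sum>d\<in>D. f a b c d) = (\<Sum>c\<in>C. \<Sum>d\<in>D. \<Sum>a\<in>A. \<Sum>b\<in>B. f a b c d)"
  using sum.swap[of "\<lambda>p q. f (fst p) (snd p) (fst q) (snd q)" "C \<times> D" "A \<times> B"]
  by (simp only: sum.cartesian_product' fst_conv snd_conv)

lemma chan_le_1:
  fixes W :: "'x \<Rightarrow> 's::finite \<Rightarrow> ('y::finite \<times> 's) pmf"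
  assumes "length ys = length xs"
  shows "chan W P0 xs ys \<le> 1"
proof -
  have "ys \<in> blocks (length xs)" "xs \<in> blocks (length xs)" using assms by (simp_all add: blocks_def)
  thus ?thesis
    using member_le_sum[of ys "blocks (length xs)" "chan W P0 xs"] sum_chan[of xs "length xs" W P0]
    by (simp add: chan_nonneg)
qed

lemma inverse_card_power:
  "(\<Sum>ys\<in>(blocks N :: 'y::finite list set). 1 / real CARD('y) ^ N) = 1"
  by (simp add: card_blocks)

abbreviation dirinf ::
  "('x::finite \<Rightarrow> 's::finite \<Rightarrow> ('y::finite \<times> 's) pmf) \<Rightarrow> 's pmf \<Rightarrow> ('y \<Rightarrow> 'z) \<Rightarrow> nat
     \<Rightarrow> ('x, 'z) input_policy \<Rightarrow> real" where
  "dirinf W P0 z N Q \<equiv> directed_info N (joint_law W P0 z N Q)"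

context
  fixes W :: "'x::finite \<Rightarrow> 's::finite \<Rightarrow> ('y::finite \<times> 's) pmf"
    and z :: "'y \<Rightarrow> 'z"
begin

text \<open>Gibbs' inequality against the law whose outputs follow \<open>out_mass\<close> and whose
  inputs are drawn causally from their feedback; the policy cancels from the likelihood
  ratio.\<close>

lemma dirinf_nonneg: "0 \<le> dirinf W P0 z N Q"
  unfolding directed_info_joint_law
proof (rule sum_mult_log_nonneg2[where q = "\<lambda>xs ys. causal_input Q xs (map z ys) * out_mass W P0 z Q ys"])
  fix xs :: "'x list" and ys :: "'y list"
  assume "xs \<in> blocks N" "ys \<in> blocks N" "0 < path_mass W P0 z Q xs ys"
  note path_mass_pos[OF this(3)]
  thus "0 < causal_input Q xs (map z ys) * out_mass W P0 z Q ys \<and>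
    log 2 (path_mass W P0 z Q xs ys / (causal_input Q xs (map z ys) * out_mass W P0 z Q ys))
      \<le> log 2 (chan W P0 xs ys / out_mass W P0 z Q ys)"
    using \<open>xs \<in> blocks N\<close> \<open>ys \<in> blocks N\<close> by (simp add: path_mass_def blocks_def)
next
  have "(\<Sum>xs\<in>blocks N. \<Sum>ys\<in>blocks N. causal_input Q xs (map z ys) * out_mass W P0 z Q ys) =
    (\<Sum>ys\<in>blocks N. (\<Sum>xs\<in>blocks N. causal_input Q xs (map z ys)) * out_mass W P0 z Q ys)"
    by (subst sum.swap) (simp add: sum_distrib_right)
  also have "\<dots> = 1" by (simp add: sum_causal_input map_in_blocks sum_out_mass)
  finally show "(\<Sum>xs\<in>blocks N. \<Sum>ys\<in>blocks N. causal_input Q xs (map z ys) * out_mass W P0 z Q ys)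
    \<le> (\<Sum>xs\<in>blocks N. \<Sum>ys\<in>blocks N. path_mass W P0 z Q xs ys)"
    by (simp add: sum_path_mass)
qed (simp_all add: path_mass_nonneg causal_input_nonneg out_mass_nonneg)

text \<open>The causally conditioned output entropy is at most that of uniform outputs, by
  comparison with uniform outputs under the same causal inputs.\<close>

lemma sum_path_mass_mult_log_chan:
  "- (real N * log 2 CARD('y)) \<le>
    (\<Sum>xs\<in>blocks N. \<Sum>ys\<in>blocks N. path_mass W P0 z Q xs ys * log 2 (chan W P0 xs ys))"
proof -
  let ?l = "real N * log 2 CARD('y)"
  have "0 \<le> (\<Sum>xs\<in>blocks N. \<Sum>ys\<in>blocks N. path_mass W P0 z Q xs ys * (log 2 (chan W P0 xs ys) + ?l))"
  proof (rule sum_mult_log_nonneg2[where q = "\<lambda>xs ys. causal_input Q xs (map z ys) * (1 / real CARD('y) ^ N)"])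
    fix xs :: "'x list" and ys :: "'y list"
    assume "xs \<in> blocks N" "ys \<in> blocks N" "0 < path_mass W P0 z Q xs ys"
    note path_mass_pos[OF this(3)]
    thus "0 < causal_input Q xs (map z ys) * (1 / real CARD('y) ^ N) \<and>
      log 2 (path_mass W P0 z Q xs ys / (causal_input Q xs (map z ys) * (1 / real CARD('y) ^ N)))
        \<le> log 2 (chan W P0 xs ys) + ?l"
      using \<open>xs \<in> blocks N\<close> \<open>ys \<in> blocks N\<close>
      by (simp add: path_mass_def blocks_def log_mult log_nat_power)
  next
    have "(\<Sum>xs\<in>blocks N. \<Sum>ys\<in>blocks N. causal_input Q xs (map z ys) * (1 / real CARD('y) ^ N)) =
      (\<Sum>ys\<in>blocks N. (\<Sum>xs\<in>blocks N. causal_input Q xs (map z ys)) * (1 / real CARD('y) ^ N))"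
      by (subst sum.swap) (simp only: sum_distrib_right)
    also have "\<dots> = (\<Sum>ys\<in>(blocks N :: 'y list set). 1 / real CARD('y) ^ N)"
      by (intro sum.cong refl) (simp only: sum_causal_input map_in_blocks mult_1)
    also have "\<dots> = 1" by (rule inverse_card_power)
    finally show "(\<Sum>xs\<in>blocks N. \<Sum>ys\<in>blocks N. causal_input Q xs (map z ys) * (1 / real CARD('y) ^ N))
      \<le> (\<Sum>xs\<in>blocks N. \<Sum>ys\<in>blocks N. path_mass W P0 z Q xs ys)"
      by (simp add: sum_path_mass)
  qed (simp_all add: path_mass_nonneg causal_input_nonneg)
  also have "\<dots> = (\<Sum>xs\<in>blocks N. \<Sum>ys\<in>blocks N. path_mass W P0 z Q xs ys * log 2 (chan W P0 xs ys)) + ?l"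
    by (simp only: distrib_left sum.distrib sum_distrib_right[symmetric] sum_path_mass mult_1)
  finally show ?thesis by simp
qed

text \<open>The quotient is the posterior of the inputs given the outputs. It sums to 1, or to 0 by
  division by zero where \<open>out_mass\<close> vanishes; hence only an inequality.\<close>

lemma sum_path_mass_div_out_mass:
  assumes "\<And>ys. ys \<in> blocks N \<Longrightarrow> 0 \<le> h ys"
  shows "(\<Sum>xs\<in>blocks N. \<Sum>ys\<in>blocks N. path_mass W P0 z Q xs ys / out_mass W P0 z Q ys * h ys)
    \<le> (\<Sum>ys\<in>blocks N. h ys)"
proof -
  have "(\<Sum>xs\<in>blocks N. \<Sum>ys\<in>blocks N. path_mass W P0 z Q xs ys / out_mass W P0 z Q ys * h ys) =
    (\<Sum>ys\<in>blocks N. (\<Sum>xs\<in>blocks (length ys). path_mass W P0 z Q xs ys) / out_mass W P0 z Q ys * h ys)"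
    by (subst sum.swap, intro sum.cong refl)
      (simp add: sum_divide_distrib sum_distrib_right blocks_def)
  also have "\<dots> \<le> (\<Sum>ys\<in>blocks N. h ys)"
    using assms by (intro sum_mono) (auto simp: out_mass_def[symmetric])
  finally show ?thesis .
qed

text \<open>The output entropy is at most that of the uniform law: Gibbs with uniform outputs and
  the true posterior of the inputs. The noise entropy is dropped, as \<open>chan\<close> is at most
  1.\<close>

lemma dirinf_le: "dirinf W P0 z N Q \<le> real N * log 2 CARD('y)"
proof -
  let ?l = "real N * log 2 CARD('y)"
  let ?I = "\<lambda>xs ys. log 2 (chan W P0 xs ys / out_mass W P0 z Q ys)"
  have "0 \<le> (\<Sum>xs\<in>blocks N. \<Sum>ys\<in>blocks N. path_mass W P0 z Q xs ys * (?l - ?I xs ys))"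
  proof (rule sum_mult_log_nonneg2[where q = "\<lambda>xs ys. path_mass W P0 z Q xs ys / out_mass W P0 z Q ys * (1 / real CARD('y) ^ N)"])
    fix xs :: "'x list" and ys :: "'y list"
    assume *: "xs \<in> blocks N" "ys \<in> blocks N" "0 < path_mass W P0 z Q xs ys"
    hence len: "length ys = length xs" by (simp add: blocks_def)
    note pos = path_mass_pos[OF *(3) len]
    have "log 2 (path_mass W P0 z Q xs ys / (path_mass W P0 z Q xs ys / out_mass W P0 z Q ys * (1 / real CARD('y) ^ N)))
      = log 2 (out_mass W P0 z Q ys) + ?l"
      using * pos by (simp add: log_mult log_nat_power)
    also have "\<dots> \<le> ?l - ?I xs ys"
      using pos chan_le_1[OF len, of W P0] by (simp add: log_divide)
    finally show "0 < path_mass W P0 z Q xs ys / out_mass W P0 z Q ys * (1 / real CARD('y) ^ N) \<and>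
      log 2 (path_mass W P0 z Q xs ys / (path_mass W P0 z Q xs ys / out_mass W P0 z Q ys * (1 / real CARD('y) ^ N)))
        \<le> ?l - ?I xs ys"
      using * pos by simp
  next
    have "(\<Sum>xs\<in>blocks N. \<Sum>ys\<in>blocks N. path_mass W P0 z Q xs ys / out_mass W P0 z Q ys * (1 / real CARD('y) ^ N))
      \<le> (\<Sum>ys\<in>(blocks N :: 'y list set). 1 / real CARD('y) ^ N)"
      by (rule sum_path_mass_div_out_mass) simp
    thus "(\<Sum>xs\<in>blocks N. \<Sum>ys\<in>blocks N. path_mass W P0 z Q xs ys / out_mass W P0 z Q ys * (1 / real CARD('y) ^ N))
      \<le> (\<Sum>xs\<in>blocks N. \<Sum>ys\<in>blocks N. path_mass W P0 z Q xs ys)"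
      by (simp only: inverse_card_power sum_path_mass)
  qed (simp_all add: path_mass_nonneg out_mass_nonneg)
  also have "\<dots> = ?l - dirinf W P0 z N Q"
    by (simp only: directed_info_joint_law right_diff_distrib sum_subtractf
        sum_distrib_right[symmetric] sum_path_mass mult_1)
  finally show ?thesis by simp
qed

text \<open>The joint law of \<open>x^(n+T)\<close>, \<open>y^(n+T)\<close> and the intermediate state \<open>s_n\<close>.\<close>

definition split_mass ::
  "'s pmf \<Rightarrow> ('x, 'z) input_policy \<Rightarrow> 'x list \<Rightarrow> 'x list \<Rightarrow> 'y list \<Rightarrow> 'y list \<Rightarrow> 's \<Rightarrow> real" where
  "split_mass P0 Q xs xs' ys ys' s = causal_input Q xs (map z ys) * fwd_mass W P0 xs ys s *
     path_mass W (return_pmf s) z (later_policy Q xs (map z ys)) xs' ys'"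

lemma split_mass_nonneg: "0 \<le> split_mass P0 Q xs xs' ys ys' s"
  by (simp add: split_mass_def causal_input_nonneg fwd_mass_nonneg path_mass_nonneg)

lemma sum_split_mass:
  "length ys = length xs \<Longrightarrow>
    (\<Sum>s\<in>UNIV. split_mass P0 Q xs xs' ys ys' s) = path_mass W P0 z Q (xs @ xs') (ys @ ys')"
  by (simp add: split_mass_def path_mass_append path_mass_def[of W "return_pmf _"] chan_return)

lemma sum_split_mass_eq_1:
  "(\<Sum>xs\<in>blocks n. \<Sum>xs'\<in>blocks T. \<Sum>ys\<in>blocks n. \<Sum>ys'\<in>blocks T. \<Sum>s\<in>UNIV.
     split_mass P0 Q xs xs' ys ys' s) = 1"
proof -
  have "(\<Sum>xs\<in>blocks n. \<Sum>xs'\<in>blocks T. \<Sum>ys\<in>blocks n. \<Sum>ys'\<in>blocks T. \<Sum>s\<in>UNIV.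
     split_mass P0 Q xs xs' ys ys' s) =
    (\<Sum>xs\<in>blocks n. \<Sum>xs'\<in>blocks T. \<Sum>ys\<in>blocks n. \<Sum>ys'\<in>blocks T.
       path_mass W P0 z Q (xs @ xs') (ys @ ys'))"
    by (intro sum.cong refl sum_split_mass) (simp add: blocks_def)
  also have "\<dots> = 1"
    using sum_path_mass[of W P0 z Q "n + T"] by (simp only: sum_blocks_add)
  finally show ?thesis .
qed

text \<open>Both directed informations as expectations under one law, to which Gibbs' inequality can
  be applied. The shorter one is extended by consistency, and the state is inserted freely since the
  integrand ignores it.\<close>

lemma dirinf_diff:
  "dirinf W P0 z (n + T) Q - dirinf W P0 z n Q =
    (\<Sum>xs\<in>blocks n. \<Sum>xs'\<in>blocks T. \<Sum>ys\<in>blocks n. \<Sum>ys'\<in>blocks T. \<Sum>s\<in>UNIV.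
      split_mass P0 Q xs xs' ys ys' s *
      (log 2 (chan W P0 (xs @ xs') (ys @ ys') / out_mass W P0 z Q (ys @ ys')) -
       log 2 (chan W P0 xs ys / out_mass W P0 z Q ys)))"
proof -
  let ?l = "\<lambda>xs ys. log 2 (chan W P0 xs ys / out_mass W P0 z Q ys)"
  have "dirinf W P0 z n Q = (\<Sum>xs\<in>blocks n. \<Sum>ys\<in>blocks n.
      (\<Sum>xs'\<in>blocks T. \<Sum>ys'\<in>blocks T. path_mass W P0 z Q (xs @ xs') (ys @ ys')) * ?l xs ys)"
    unfolding directed_info_joint_law by (intro sum.cong refl) (simp add: sum_path_mass_append blocks_def[of n])
  also have "\<dots> = (\<Sum>xs\<in>blocks n. \<Sum>xs'\<in>blocks T. \<Sum>ys\<in>blocks n. \<Sum>ys'\<in>blocks T.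
      path_mass W P0 z Q (xs @ xs') (ys @ ys') * ?l xs ys)"
    unfolding sum_distrib_right by (intro sum.cong refl sum.swap)
  finally have "dirinf W P0 z (n + T) Q - dirinf W P0 z n Q =
    (\<Sum>xs\<in>blocks n. \<Sum>xs'\<in>blocks T. \<Sum>ys\<in>blocks n. \<Sum>ys'\<in>blocks T.
      path_mass W P0 z Q (xs @ xs') (ys @ ys') * (?l (xs @ xs') (ys @ ys') - ?l xs ys))"
    by (simp only: directed_info_joint_law sum_blocks_add right_diff_distrib sum_subtractf)
  also have "\<dots> = (\<Sum>xs\<in>blocks n. \<Sum>xs'\<in>blocks T. \<Sum>ys\<in>blocks n. \<Sum>ys'\<in>blocks T. \<Sum>s\<in>UNIV.
      split_mass P0 Q xs xs' ys ys' s * (?l (xs @ xs') (ys @ ys') - ?l xs ys))"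
    by (intro sum.cong refl) (simp add: blocks_def flip: sum_split_mass sum_distrib_right)
  finally show ?thesis .
qed

lemma split_mass_pos:
  assumes "0 < split_mass P0 Q xs xs' ys ys' s" "length ys = length xs" "length ys' = length xs'"
  shows "0 < causal_input Q xs (map z ys)" "0 < fwd_mass W P0 xs ys s"
    "0 < path_mass W (return_pmf s) z (later_policy Q xs (map z ys)) xs' ys'"
    "0 < chan_from W s xs' ys'" "0 < chan W P0 xs ys" "0 < chan W P0 (xs @ xs') (ys @ ys')"
    "0 < path_mass W P0 z Q xs ys" "0 < out_mass W P0 z Q ys" "0 < out_mass W P0 z Q (ys @ ys')"
    "0 < path_mass W P0 z Q (xs @ xs') (ys @ ys')"
proof -
  have "causal_input Q xs (map z ys) \<noteq> 0" "fwd_mass W P0 xs ys s \<noteq> 0"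
    "path_mass W (return_pmf s) z (later_policy Q xs (map z ys)) xs' ys' \<noteq> 0"
    using assms(1) by (auto simp: split_mass_def)
  thus *: "0 < causal_input Q xs (map z ys)" "0 < fwd_mass W P0 xs ys s"
    "0 < path_mass W (return_pmf s) z (later_policy Q xs (map z ys)) xs' ys'"
    using causal_input_nonneg[of Q xs "map z ys"] fwd_mass_nonneg[of W P0 xs ys s]
      path_mass_nonneg[of W "return_pmf s" z "later_policy Q xs (map z ys)" xs' ys'] by linarith+
  show "0 < chan W P0 xs ys" using fwd_mass_le_chan[OF assms(2), of W P0 s] *(2) by linarith
  thus "0 < path_mass W P0 z Q xs ys" using *(1) by (simp add: path_mass_def)
  show "0 < chan_from W s xs' ys'" using path_mass_pos[OF *(3) assms(3)] by (simp add: chan_return)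
  have "split_mass P0 Q xs xs' ys ys' s \<le> path_mass W P0 z Q (xs @ xs') (ys @ ys')"
    unfolding sum_split_mass[OF assms(2), symmetric]
    by (rule member_le_sum) (auto simp: split_mass_nonneg)
  thus pm: "0 < path_mass W P0 z Q (xs @ xs') (ys @ ys')" using assms(1) by linarith
  show "0 < chan W P0 (xs @ xs') (ys @ ys')" "0 < out_mass W P0 z Q (ys @ ys')"
    using path_mass_pos[OF pm] assms by auto
  show "0 < out_mass W P0 z Q ys"
    using path_mass_pos[OF \<open>0 < path_mass W P0 z Q xs ys\<close> assms(2)] by simp
qed

text \<open>Revealing the past inputs and the intermediate state can only lower the entropy of the
  later outputs, while not knowing the state raises the entropy of the later noise by at most
  \<open>log 2 CARD('s)\<close>.\<close>

lemma dirinf_add_ge: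
  "dirinf W P0 z n Q + (\<Sum>xs\<in>blocks n. \<Sum>ys\<in>blocks n. \<Sum>s\<in>UNIV.
      causal_input Q xs (map z ys) * fwd_mass W P0 xs ys s *
      dirinf W (return_pmf s) z T (later_policy Q xs (map z ys))) - log 2 CARD('s)
    \<le> dirinf W P0 z (n + T) Q"
proof -
  let ?R = "\<lambda>xs ys. later_policy Q xs (map z ys)"
  let ?pm = "\<lambda>xs xs' ys ys' s. path_mass W (return_pmf s) z (?R xs ys) xs' ys'"
  let ?om = "\<lambda>xs ys ys' s. out_mass W (return_pmf s) z (?R xs ys) ys'"
  let ?l = "\<lambda>xs ys. log 2 (chan W P0 xs ys / out_mass W P0 z Q ys)"
  let ?c = "real CARD('s)"
  let ?f = "\<lambda>xs xs' ys ys' s. (?l (xs @ xs') (ys @ ys') - ?l xs ys) + log 2 ?c -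
    log 2 (chan_from W s xs' ys' / ?om xs ys ys' s)"
  \<comment> \<open>Uniform intermediate state, true law of all outputs, and for each block the
    posterior of its inputs given its outputs; for the second block also given the past and the
    state.\<close>
  let ?q = "\<lambda>xs xs' ys ys' s. 1 / ?c * (path_mass W P0 z Q xs ys / out_mass W P0 z Q ys *
    (out_mass W P0 z Q (ys @ ys') * (?pm xs xs' ys ys' s / ?om xs ys ys' s)))"
  have "0 \<le> (\<Sum>xs\<in>blocks n. \<Sum>xs'\<in>blocks T. \<Sum>ys\<in>blocks n. \<Sum>ys'\<in>blocks T. \<Sum>s\<in>UNIV.
      split_mass P0 Q xs xs' ys ys' s * ?f xs xs' ys ys' s)"
  proof (rule sum_mult_log_nonneg5[where q = ?q])
    fix xs xs' :: "'x list" and ys ys' :: "'y list" and s :: 's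
    assume bl: "xs \<in> blocks n" "xs' \<in> blocks T" "ys \<in> blocks n" "ys' \<in> blocks T"
      and p: "0 < split_mass P0 Q xs xs' ys ys' s"
    hence len: "length ys = length xs" "length ys' = length xs'" by (auto simp: blocks_def)
    note pos = split_mass_pos[OF p len]
    have om: "0 < ?om xs ys ys' s" using path_mass_pos[OF pos(3) len(2)] by simp
    have "split_mass P0 Q xs xs' ys ys' s / ?q xs xs' ys ys' s =
      ?c * fwd_mass W P0 xs ys s * out_mass W P0 z Q ys * ?om xs ys ys' s /
        (chan W P0 xs ys * out_mass W P0 z Q (ys @ ys'))"
      using pos om unfolding split_mass_def path_mass_def[of W P0 z Q xs ys]
      by (simp add: field_simps)
    \<comment> \<open>Only the term of the actual state s is kept from the sum over intermediate
      states in \<open>chan_append\<close>.\<close>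
    also have "\<dots> \<le> ?c * (chan W P0 (xs @ xs') (ys @ ys') / chan_from W s xs' ys') * out_mass W P0 z Q ys *
        ?om xs ys ys' s / (chan W P0 xs ys * out_mass W P0 z Q (ys @ ys'))"
      using pos om fwd_mass_mult_le_chan[OF len(1), of W P0 s xs' ys']
      by (intro divide_right_mono mult_right_mono mult_left_mono) (auto simp: field_simps)
    finally have "log 2 (split_mass P0 Q xs xs' ys ys' s / ?q xs xs' ys ys' s) \<le>
      log 2 (?c * (chan W P0 (xs @ xs') (ys @ ys') / chan_from W s xs' ys') * out_mass W P0 z Q ys *
        ?om xs ys ys' s / (chan W P0 xs ys * out_mass W P0 z Q (ys @ ys')))"
      using pos om p by (intro log_mono) auto
    also have "\<dots> = ?f xs xs' ys ys' s"
      using pos om by (simp add: log_mult log_divide)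
    finally show "0 < ?q xs xs' ys ys' s \<and>
      log 2 (split_mass P0 Q xs xs' ys ys' s / ?q xs xs' ys ys' s) \<le> ?f xs xs' ys ys' s"
      using pos om by simp
  next
    have "(\<Sum>xs'\<in>blocks T. ?pm xs xs' ys ys' s / ?om xs ys ys' s) \<le> 1" if "ys' \<in> blocks T" for xs ys ys' s
      using that by (simp add: sum_divide_distrib[symmetric] out_mass_def blocks_def)
    hence le: "(\<Sum>xs'\<in>blocks T. out_mass W P0 z Q (ys @ ys') * (?pm xs xs' ys ys' s / ?om xs ys ys' s))
      \<le> out_mass W P0 z Q (ys @ ys')" if "ys' \<in> blocks T" for xs ys ys' s
      using that by (simp only: sum_distrib_left[symmetric]) (simp add: mult_left_le out_mass_nonneg)
    have le: "(\<Sum>xs'\<in>blocks T. \<Sum>ys'\<in>blocks T. out_mass W P0 z Q (ys @ ys') * (?pm xs xs' ys ys' s / ?om xs ys ys' s))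
      \<le> (\<Sum>ys'\<in>blocks T. out_mass W P0 z Q (ys @ ys'))" for xs ys s
      by (subst sum.swap, intro sum_mono le)
    have "(\<Sum>xs\<in>blocks n. \<Sum>xs'\<in>blocks T. \<Sum>ys\<in>blocks n. \<Sum>ys'\<in>blocks T. \<Sum>s\<in>UNIV. ?q xs xs' ys ys' s) =
      (\<Sum>xs\<in>blocks n. \<Sum>ys\<in>blocks n. \<Sum>s\<in>UNIV. 1 / ?c * (path_mass W P0 z Q xs ys / out_mass W P0 z Q ys *
        (\<Sum>xs'\<in>blocks T. \<Sum>ys'\<in>blocks T. out_mass W P0 z Q (ys @ ys') * (?pm xs xs' ys ys' s / ?om xs ys ys' s))))"
      by (subst sum_reorder5) (simp only: sum_distrib_left)
    also have "\<dots> \<le> (\<Sum>xs\<in>blocks n. \<Sum>ys\<in>blocks n. \<Sum>s\<in>(UNIV::'s set). 1 / ?c * (path_mass W P0 z Q xs ys / out_mass W P0 z Q ys *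
        (\<Sum>ys'\<in>blocks T. out_mass W P0 z Q (ys @ ys'))))"
      by (intro sum_mono mult_left_mono le) (auto simp: path_mass_nonneg out_mass_nonneg)
    also have "\<dots> = (\<Sum>xs\<in>blocks n. \<Sum>ys\<in>blocks n. path_mass W P0 z Q xs ys / out_mass W P0 z Q ys *
        (\<Sum>ys'\<in>blocks T. out_mass W P0 z Q (ys @ ys')))"
      by simp
    also have "\<dots> \<le> (\<Sum>ys\<in>blocks n. \<Sum>ys'\<in>blocks T. out_mass W P0 z Q (ys @ ys'))"
      by (intro sum_path_mass_div_out_mass sum_nonneg out_mass_nonneg)
    also have "\<dots> = 1"
      using sum_out_mass[of W P0 z Q "n + T"] by (simp only: sum_blocks_add)
    finally show "(\<Sum>xs\<in>blocks n. \<Sum>xs'\<in>blocks T. \<Sum>ys\<in>blocks n. \<Sum>ys'\<in>blocks T. \<Sum>s\<in>UNIV. ?q xs xs' ys ys' s)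
      \<le> (\<Sum>xs\<in>blocks n. \<Sum>xs'\<in>blocks T. \<Sum>ys\<in>blocks n. \<Sum>ys'\<in>blocks T. \<Sum>s\<in>UNIV. split_mass P0 Q xs xs' ys ys' s)"
      by (simp only: sum_split_mass_eq_1)
  qed (simp_all add: split_mass_nonneg path_mass_nonneg out_mass_nonneg)
  also have "\<dots> = dirinf W P0 z (n + T) Q - dirinf W P0 z n Q + log 2 ?c -
    (\<Sum>xs\<in>blocks n. \<Sum>xs'\<in>blocks T. \<Sum>ys\<in>blocks n. \<Sum>ys'\<in>blocks T. \<Sum>s\<in>UNIV.
      split_mass P0 Q xs xs' ys ys' s * log 2 (chan_from W s xs' ys' / ?om xs ys ys' s))"
    unfolding dirinf_diff
    by (simp only: right_diff_distrib[of _ "_ + _"] distrib_left[of _ _ "log 2 ?c"] sum_subtractf sum.distrib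
        sum_distrib_right[symmetric] sum_split_mass_eq_1 mult_1)
  also have "(\<Sum>xs\<in>blocks n. \<Sum>xs'\<in>blocks T. \<Sum>ys\<in>blocks n. \<Sum>ys'\<in>blocks T. \<Sum>s\<in>UNIV.
      split_mass P0 Q xs xs' ys ys' s * log 2 (chan_from W s xs' ys' / ?om xs ys ys' s)) =
    (\<Sum>xs\<in>blocks n. \<Sum>ys\<in>blocks n. \<Sum>s\<in>UNIV.
      causal_input Q xs (map z ys) * fwd_mass W P0 xs ys s * dirinf W (return_pmf s) z T (?R xs ys))"
    by (subst sum_reorder5)
      (simp only: split_mass_def directed_info_joint_law chan_return sum_distrib_left mult.assoc)
  finally show ?thesis by simp
qed

text \<open>\<open>r k s\<close> is an arbitrary test law for the output of the last \<open>T\<close> steps: the true output law is compared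
  with the uniform mixture of all \<open>r k s\<close>, which loses \<open>log (card K * CARD('s))\<close>.\<close>

lemma dirinf_diff_le:
  fixes \<kappa> :: "'x list \<Rightarrow> 'z list \<Rightarrow> 'k" and r :: "'k \<Rightarrow> 's \<Rightarrow> 'y list \<Rightarrow> real"
  assumes K: "finite K" "\<And>xs zs. \<kappa> xs zs \<in> K"
    and r_pos: "\<And>k s ys. 0 < r k s ys"
    and r_sum: "\<And>k s. (\<Sum>ys\<in>blocks T. r k s ys) \<le> 1"
  shows "dirinf W P0 z (n + T) Q - dirinf W P0 z n Q \<le>
    (\<Sum>xs\<in>blocks n. \<Sum>ys\<in>blocks n. \<Sum>s\<in>UNIV. causal_input Q xs (map z ys) * fwd_mass W P0 xs ys s *
      (\<Sum>xs'\<in>blocks T. \<Sum>ys'\<in>blocks T. path_mass W (return_pmf s) z (later_policy Q xs (map z ys)) xs' ys' *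
        (log 2 (chan_from W s xs' ys') - log 2 (r (\<kappa> xs (map z ys)) s ys')))) + log 2 (card K * CARD('s))"
proof -
  define c where "c = real (card K * CARD('s))"
  have "K \<noteq> {}" using K(2) by auto
  hence c: "0 < c" using K(1) by (simp add: c_def card_gt_0_iff)
  define R where "R ys = (\<Sum>k\<in>K. \<Sum>s\<in>UNIV. r k s ys) / c" for ys
  have r_le: "r k s ys / c \<le> R ys" if "k \<in> K" for k s ys
  proof -
    have "r k s ys \<le> (\<Sum>s\<in>UNIV. r k s ys)"
      by (rule member_le_sum) (auto intro: less_imp_le r_pos)
    also have "\<dots> \<le> (\<Sum>k\<in>K. \<Sum>s\<in>UNIV. r k s ys)"
      using that K(1) by (intro member_le_sum[of k K] sum_nonneg less_imp_le[OF r_pos])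
    finally show ?thesis unfolding R_def using c by (intro divide_right_mono) auto
  qed
  obtain k0 where "k0 \<in> K" using \<open>K \<noteq> {}\<close> by auto
  have R_pos: "0 < R ys" for ys
    using r_le[OF \<open>k0 \<in> K\<close>, of undefined ys] divide_pos_pos[OF r_pos[of k0 undefined ys] c] by linarith
  have R_sum: "(\<Sum>ys\<in>blocks T. R ys) \<le> 1"
  proof -
    have "(\<Sum>ys\<in>blocks T. R ys) = (\<Sum>k\<in>K. \<Sum>s\<in>UNIV. \<Sum>ys\<in>blocks T. r k s ys) / c"
      unfolding R_def sum_divide_distrib[symmetric]
      by (subst sum.swap) (intro arg_cong2[where f = divide] sum.cong refl sum.swap)
    also have "\<dots> \<le> (\<Sum>k\<in>K. \<Sum>s\<in>(UNIV::'s set). 1) / c"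
      using c by (intro divide_right_mono sum_mono r_sum) auto
    also have "\<dots> = 1" using \<open>K \<noteq> {}\<close> K(1) by (simp add: c_def card_gt_0_iff)
    finally show ?thesis .
  qed
  let ?R = "\<lambda>xs ys. later_policy Q xs (map z ys)"
  let ?l = "\<lambda>xs ys. log 2 (chan W P0 xs ys / out_mass W P0 z Q ys)"
  let ?g = "\<lambda>xs xs' ys ys' s. log 2 (chan_from W s xs' ys') - log 2 (r (\<kappa> xs (map z ys)) s ys')"
  let ?f = "\<lambda>xs xs' ys ys' s. ?g xs xs' ys ys' s + log 2 c - (?l (xs @ xs') (ys @ ys') - ?l xs ys)"
  \<comment> \<open>True posterior of the inputs given all outputs and of the state given the past,
    true output law on the first n steps, and independently of it the mixture \<open>R\<close> on
    the last T.\<close>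
  let ?q = "\<lambda>xs xs' ys ys' s. fwd_mass W P0 xs ys s / chan W P0 xs ys *
    (path_mass W P0 z Q (xs @ xs') (ys @ ys') / out_mass W P0 z Q (ys @ ys') * (out_mass W P0 z Q ys * R ys'))"
  have "0 \<le> (\<Sum>xs\<in>blocks n. \<Sum>xs'\<in>blocks T. \<Sum>ys\<in>blocks n. \<Sum>ys'\<in>blocks T. \<Sum>s\<in>UNIV.
      split_mass P0 Q xs xs' ys ys' s * ?f xs xs' ys ys' s)"
  proof (rule sum_mult_log_nonneg5[where q = ?q])
    fix xs xs' :: "'x list" and ys ys' :: "'y list" and s :: 's
    assume bl: "xs \<in> blocks n" "xs' \<in> blocks T" "ys \<in> blocks n" "ys' \<in> blocks T"
      and p: "0 < split_mass P0 Q xs xs' ys ys' s"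
    hence len: "length ys = length xs" "length ys' = length xs'" by (auto simp: blocks_def)
    note pos = split_mass_pos[OF p len]
    have ci: "causal_input (?R xs ys) xs' (map z ys') > 0" using path_mass_pos[OF pos(3) len(2)] by simp
    note rp = r_pos[of "\<kappa> xs (map z ys)" s ys']
    have "split_mass P0 Q xs xs' ys ys' s / ?q xs xs' ys ys' s =
      chan_from W s xs' ys' * chan W P0 xs ys * out_mass W P0 z Q (ys @ ys') /
        (chan W P0 (xs @ xs') (ys @ ys') * out_mass W P0 z Q ys * R ys')"
      using pos R_pos[of ys'] ci len(1)
      unfolding split_mass_def path_mass_def by (simp add: causal_input_append chan_return field_simps)
    also have "\<dots> \<le> chan_from W s xs' ys' * chan W P0 xs ys * out_mass W P0 z Q (ys @ ys') /
        (chan W P0 (xs @ xs') (ys @ ys') * out_mass W P0 z Q ys * (r (\<kappa> xs (map z ys)) s ys' / c))"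
      using pos R_pos[of ys'] r_le[OF K(2)] rp c
      by (intro divide_left_mono mult_left_mono mult_pos_pos mult_nonneg_nonneg divide_pos_pos) auto
    finally have "log 2 (split_mass P0 Q xs xs' ys ys' s / ?q xs xs' ys ys' s) \<le>
      log 2 (chan_from W s xs' ys' * chan W P0 xs ys * out_mass W P0 z Q (ys @ ys') /
        (chan W P0 (xs @ xs') (ys @ ys') * out_mass W P0 z Q ys * (r (\<kappa> xs (map z ys)) s ys' / c)))"
      using pos R_pos[of ys'] p by (intro log_mono) auto
    also have "\<dots> = ?f xs xs' ys ys' s"
      using pos rp c by (simp add: log_mult log_divide)
    finally show "0 < ?q xs xs' ys ys' s \<and>
      log 2 (split_mass P0 Q xs xs' ys ys' s / ?q xs xs' ys ys' s) \<le> ?f xs xs' ys ys' s"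
      using pos R_pos[of ys'] by simp
  next
    \<comment> \<open>The posterior of the state sums to 1, or to 0 where \<open>chan\<close>
      vanishes. With \<open>take\<close> and \<open>drop\<close> the summand depends on the whole
      lists only, so the sums over both blocks merge into sums over length n + T.\<close>
    have le: "(\<Sum>s\<in>UNIV. ?q xs xs' ys ys' s) \<le>
      path_mass W P0 z Q (xs @ xs') (ys @ ys') / out_mass W P0 z Q (ys @ ys') *
        (out_mass W P0 z Q (take n (ys @ ys')) * R (drop n (ys @ ys')))"
      if "xs \<in> blocks n" "ys \<in> blocks n" for xs xs' ys ys'
    proof -
      have *: "length ys = length xs" "length ys = n" using that by (auto simp: blocks_def)
      have "(\<Sum>s\<in>UNIV. ?q xs xs' ys ys' s) = (chan W P0 xs ys / chan W P0 xs ys) *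
        (path_mass W P0 z Q (xs @ xs') (ys @ ys') / out_mass W P0 z Q (ys @ ys') * (out_mass W P0 z Q ys * R ys'))"
        by (simp only: sum_distrib_right[symmetric] sum_divide_distrib[symmetric] chan_eq_sum_fwd_mass[OF *(1)])
      also have "\<dots> \<le> 1 * (path_mass W P0 z Q (xs @ xs') (ys @ ys') / out_mass W P0 z Q (ys @ ys') * (out_mass W P0 z Q ys * R ys'))"
        by (intro mult_right_mono mult_nonneg_nonneg divide_nonneg_nonneg)
          (auto simp: path_mass_nonneg out_mass_nonneg less_imp_le[OF R_pos])
      finally show ?thesis by (simp add: *(2))
    qed
    have "(\<Sum>xs\<in>blocks n. \<Sum>xs'\<in>blocks T. \<Sum>ys\<in>blocks n. \<Sum>ys'\<in>blocks T. \<Sum>s\<in>UNIV. ?q xs xs' ys ys' s) \<le>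
      (\<Sum>xs\<in>blocks n. \<Sum>xs'\<in>blocks T. \<Sum>ys\<in>blocks n. \<Sum>ys'\<in>blocks T.
        path_mass W P0 z Q (xs @ xs') (ys @ ys') / out_mass W P0 z Q (ys @ ys') *
        (out_mass W P0 z Q (take n (ys @ ys')) * R (drop n (ys @ ys'))))"
      by (intro sum_mono le)
    also have "\<dots> = (\<Sum>xs\<in>blocks (n + T). \<Sum>ys\<in>blocks (n + T).
        path_mass W P0 z Q xs ys / out_mass W P0 z Q ys * (out_mass W P0 z Q (take n ys) * R (drop n ys)))"
      by (simp only: sum_blocks_add)
    also have "\<dots> \<le> (\<Sum>ys\<in>blocks (n + T). out_mass W P0 z Q (take n ys) * R (drop n ys))"
      by (intro sum_path_mass_div_out_mass mult_nonneg_nonneg out_mass_nonneg less_imp_le[OF R_pos])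
    also have "\<dots> = (\<Sum>ys\<in>blocks n. \<Sum>ys'\<in>blocks T. out_mass W P0 z Q ys * R ys')"
      unfolding sum_blocks_add by (intro sum.cong refl) (simp add: blocks_def)
    also have "\<dots> = (\<Sum>ys'\<in>blocks T. R ys')"
      by (simp add: sum_out_mass flip: sum_distrib_left sum_distrib_right)
    also have "\<dots> \<le> 1" by (rule R_sum)
    finally show "(\<Sum>xs\<in>blocks n. \<Sum>xs'\<in>blocks T. \<Sum>ys\<in>blocks n. \<Sum>ys'\<in>blocks T. \<Sum>s\<in>UNIV. ?q xs xs' ys ys' s)
      \<le> (\<Sum>xs\<in>blocks n. \<Sum>xs'\<in>blocks T. \<Sum>ys\<in>blocks n. \<Sum>ys'\<in>blocks T. \<Sum>s\<in>UNIV. split_mass P0 Q xs xs' ys ys' s)"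
      by (simp only: sum_split_mass_eq_1)
  qed (auto simp: split_mass_nonneg path_mass_nonneg out_mass_nonneg fwd_mass_nonneg chan_nonneg less_imp_le[OF R_pos])
  also have "\<dots> = (\<Sum>xs\<in>blocks n. \<Sum>xs'\<in>blocks T. \<Sum>ys\<in>blocks n. \<Sum>ys'\<in>blocks T. \<Sum>s\<in>UNIV.
      split_mass P0 Q xs xs' ys ys' s * ?g xs xs' ys ys' s) + log 2 c -
    (dirinf W P0 z (n + T) Q - dirinf W P0 z n Q)"
    unfolding dirinf_diff
    by (simp only: right_diff_distrib[of _ "_ + _"] distrib_left[of _ _ "log 2 c"] sum_subtractf sum.distrib
        sum_distrib_right[symmetric] sum_split_mass_eq_1 mult_1)
  also have "(\<Sum>xs\<in>blocks n. \<Sum>xs'\<in>blocks T. \<Sum>ys\<in>blocks n. \<Sum>ys'\<in>blocks T. \<Sum>s\<in>UNIV.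
      split_mass P0 Q xs xs' ys ys' s * ?g xs xs' ys ys' s) =
    (\<Sum>xs\<in>blocks n. \<Sum>ys\<in>blocks n. \<Sum>s\<in>UNIV. causal_input Q xs (map z ys) * fwd_mass W P0 xs ys s *
      (\<Sum>xs'\<in>blocks T. \<Sum>ys'\<in>blocks T. path_mass W (return_pmf s) z (?R xs ys) xs' ys' * ?g xs xs' ys ys' s))"
    by (subst sum_reorder5) (simp only: split_mass_def sum_distrib_left mult.assoc)
  finally show ?thesis by (simp add: c_def)
qed

end

section \<open>Quantised encoder beliefs\<close>

text \<open>Think of u as a past of mass \<open>\<mu> u\<close>, of \<open>\<rho> u s\<close> as its
  joint mass with the state and of \<open>\<beta> k\<close> as the rounded belief of a cell. Within
  a cell u and s are nearly independent, so \<psi> may be replaced by its \<mu>-mean \<Psi>; the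
  error is a covariance, at most \<delta> times the oscillation 2 C.\<close>

lemma quantised_sum_le:
  fixes \<rho> \<psi> :: "'u \<Rightarrow> 's::finite \<Rightarrow> real" and \<beta> \<Psi> :: "'k \<Rightarrow> 's \<Rightarrow> real"
  assumes fin: "finite U" "finite K" "\<kappa> ` U \<subseteq> K"
    and quant: "\<And>u s. u \<in> U \<Longrightarrow> \<bar>\<rho> u s - \<beta> (\<kappa> u) s * \<mu> u\<bar> \<le> \<delta> * \<mu> u"
    and mean: "\<And>k s. (\<Sum>u | u \<in> U \<and> \<kappa> u = k. \<mu> u * \<psi> u s) = (\<Sum>u | u \<in> U \<and> \<kappa> u = k. \<mu> u) * \<Psi> k s"
    and bd: "\<And>u s. u \<in> U \<Longrightarrow> \<bar>\<psi> u s\<bar> \<le> C" "\<And>k s. \<bar>\<Psi> k s\<bar> \<le> C"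
  shows "(\<Sum>u\<in>U. \<Sum>s\<in>UNIV. \<rho> u s * \<psi> u s) \<le>
    (\<Sum>k\<in>K. \<Sum>s\<in>UNIV. (\<Sum>u | u \<in> U \<and> \<kappa> u = k. \<rho> u s) * \<Psi> k s) + 2 * C * \<delta> * CARD('s) * sum \<mu> U"
proof -
  have cell: "(\<Sum>u | u \<in> U \<and> \<kappa> u = k. \<rho> u s * \<psi> u s) \<le>
    (\<Sum>u | u \<in> U \<and> \<kappa> u = k. \<rho> u s) * \<Psi> k s + 2 * C * \<delta> * (\<Sum>u | u \<in> U \<and> \<kappa> u = k. \<mu> u)" for k s
  proof -
    let ?U = "{u. u \<in> U \<and> \<kappa> u = k}"
    \<comment> \<open>Subtracting \<open>\<beta> k s\<close> times the identity \<open>mean\<close>,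
      which is zero, turns the error into a sum of products of deviations.\<close>
    have "(\<Sum>u\<in>?U. \<rho> u s * \<psi> u s) - (\<Sum>u\<in>?U. \<rho> u s) * \<Psi> k s =
      (\<Sum>u\<in>?U. \<rho> u s * \<psi> u s) - (\<Sum>u\<in>?U. \<rho> u s) * \<Psi> k s
        - \<beta> k s * ((\<Sum>u\<in>?U. \<mu> u * \<psi> u s) - (\<Sum>u\<in>?U. \<mu> u) * \<Psi> k s)"
      by (simp only: mean) simp
    also have "\<dots> = (\<Sum>u\<in>?U. (\<rho> u s - \<beta> k s * \<mu> u) * (\<psi> u s - \<Psi> k s))"
      by (simp add: algebra_simps sum.distrib sum_subtractf sum_distrib_left)
    also have "\<dots> \<le> (\<Sum>u\<in>?U. \<delta> * \<mu> u * (2 * C))"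
    proof (intro sum_mono)
      fix u assume "u \<in> ?U"
      hence u: "\<bar>\<rho> u s - \<beta> k s * \<mu> u\<bar> \<le> \<delta> * \<mu> u" "\<bar>\<psi> u s\<bar> \<le> C" using quant bd by auto
      hence "\<bar>\<psi> u s - \<Psi> k s\<bar> \<le> 2 * C" using bd(2)[of k s] by linarith
      hence "\<bar>\<rho> u s - \<beta> k s * \<mu> u\<bar> * \<bar>\<psi> u s - \<Psi> k s\<bar> \<le> \<delta> * \<mu> u * (2 * C)"
        using u by (intro mult_mono) auto
      thus "(\<rho> u s - \<beta> k s * \<mu> u) * (\<psi> u s - \<Psi> k s) \<le> \<delta> * \<mu> u * (2 * C)"
        by (metis abs_ge_self abs_mult order_trans)
    qed
    also have "\<dots> = 2 * C * \<delta> * (\<Sum>u\<in>?U. \<mu> u)" by (simp add: sum_distrib_left mult_ac)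
    finally show ?thesis by simp
  qed
  have group: "(\<Sum>k\<in>K. \<Sum>u | u \<in> U \<and> \<kappa> u = k. h u) = sum h U" for h :: "'u \<Rightarrow> real"
    using fin by (intro sum.group) auto
  have "(\<Sum>u\<in>U. \<Sum>s\<in>UNIV. \<rho> u s * \<psi> u s) = (\<Sum>k\<in>K. \<Sum>s\<in>UNIV. \<Sum>u | u \<in> U \<and> \<kappa> u = k. \<rho> u s * \<psi> u s)"
    unfolding group[symmetric] by (intro sum.cong refl sum.swap)
  also have "\<dots> \<le> (\<Sum>k\<in>K. \<Sum>s\<in>UNIV. (\<Sum>u | u \<in> U \<and> \<kappa> u = k. \<rho> u s) * \<Psi> k s +
      2 * C * \<delta> * (\<Sum>u | u \<in> U \<and> \<kappa> u = k. \<mu> u))"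
    by (intro sum_mono cell)
  also have "\<dots> = (\<Sum>k\<in>K. \<Sum>s\<in>UNIV. (\<Sum>u | u \<in> U \<and> \<kappa> u = k. \<rho> u s) * \<Psi> k s) +
      2 * C * \<delta> * CARD('s) * (\<Sum>k\<in>K. \<Sum>u | u \<in> U \<and> \<kappa> u = k. \<mu> u)"
    by (simp add: sum.distrib sum_distrib_left mult_ac)
  finally show ?thesis by (simp only: group)
qed

text \<open>The joint law of the encoder's cell and the state after n steps.\<close>

definition occupation ::
  "('x::finite \<Rightarrow> 's::finite \<Rightarrow> ('y::finite \<times> 's) pmf) \<Rightarrow> 's pmf \<Rightarrow> ('y \<Rightarrow> 'z) \<Rightarrow> nat
     \<Rightarrow> ('x, 'z) input_policy \<Rightarrow> ('x list \<Rightarrow> 'z list \<Rightarrow> 'k) \<Rightarrow> 'k \<Rightarrow> 's \<Rightarrow> real" where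
  "occupation W P0 z n Q \<kappa> k s = (\<Sum>xs\<in>blocks n. \<Sum>ys\<in>blocks n.
     if \<kappa> xs (map z ys) = k then causal_input Q xs (map z ys) * fwd_mass W P0 xs ys s else 0)"

definition switch_policy ::
  "nat \<Rightarrow> ('x, 'z) input_policy \<Rightarrow> ('x list \<Rightarrow> 'z list \<Rightarrow> 'k) \<Rightarrow> ('k \<Rightarrow> ('x, 'z) input_policy)
     \<Rightarrow> ('x, 'z) input_policy" where
  "switch_policy n Q \<kappa> R xs zs = (if length xs < n then Q xs zs
     else R (\<kappa> (take n xs) (take n zs)) (drop n xs) (drop n zs))"

text \<open>A cell is the vector of numerators of a rounded belief: \<open>k s / M\<close> stands
  for the probability of s.\<close>

definition levels :: "nat \<Rightarrow> ('s::finite \<Rightarrow> nat) set" where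
  "levels M = {k. \<forall>s. k s \<le> M}"

lemma finite_levels: "finite (levels M :: ('s::finite \<Rightarrow> nat) set)"
proof -
  have "levels M = PiE (UNIV :: 's set) (\<lambda>_. {..M})"
    by (auto simp: levels_def PiE_def extensional_def)
  thus ?thesis by (simp add: finite_PiE)
qed

text \<open>Rounding of the ratio a / b, with the error multiplied out so that a past of mass b = 0
  is no exception.\<close>

lemma nat_floor_approx:
  fixes a b :: real
  assumes "0 \<le> a" "a \<le> b" "0 < M"
  shows "nat \<lfloor>real M * a / b\<rfloor> \<le> M" "\<bar>a - real (nat \<lfloor>real M * a / b\<rfloor>) / real M * b\<bar> \<le> 1 / real M * b"
proof -
  let ?t = "real M * a / b"
  have t0: "0 \<le> ?t" using assms by simp
  have t1: "?t \<le> real M" using assms by (cases "b = 0") (auto simp: divide_le_eq mult_left_mono)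
  show "nat \<lfloor>?t\<rfloor> \<le> M" using t1 by linarith
  have "real (nat \<lfloor>?t\<rfloor>) = of_int \<lfloor>?t\<rfloor>" using t0 by simp
  hence *: "\<bar>?t - real (nat \<lfloor>?t\<rfloor>)\<bar> \<le> 1" by linarith
  show "\<bar>a - real (nat \<lfloor>?t\<rfloor>) / real M * b\<bar> \<le> 1 / real M * b"
  proof (cases "b = 0")
    case True
    thus ?thesis using assms by simp
  next
    case False
    hence b: "0 < b" using assms by simp
    have "a - real (nat \<lfloor>?t\<rfloor>) / real M * b = (?t - real (nat \<lfloor>?t\<rfloor>)) * (b / real M)"
      using b assms by (simp add: field_simps)
    hence "\<bar>a - real (nat \<lfloor>?t\<rfloor>) / real M * b\<bar> = \<bar>?t - real (nat \<lfloor>?t\<rfloor>)\<bar> * (b / real M)"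
      using b by (simp add: abs_mult)
    also have "\<dots> \<le> 1 * (b / real M)" using * b by (intro mult_right_mono) auto
    finally show ?thesis by simp
  qed
qed

context
  fixes W :: "'x::finite \<Rightarrow> 's::finite \<Rightarrow> ('y::finite \<times> 's) pmf"
    and z :: "'y \<Rightarrow> 'z::finite"
begin

lemma sum_occupation:
  fixes \<kappa> :: "'x list \<Rightarrow> 'z list \<Rightarrow> 'k"
  assumes "finite K" "\<And>xs zs. \<kappa> xs zs \<in> K"
  shows "(\<Sum>xs\<in>blocks n. \<Sum>ys\<in>blocks n. \<Sum>s\<in>UNIV.
      causal_input Q xs (map z ys) * fwd_mass W P0 xs ys s * F (\<kappa> xs (map z ys)) s) =
    (\<Sum>k\<in>K. \<Sum>s\<in>UNIV. occupation W P0 z n Q \<kappa> k s * F k s)"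
proof -
  let ?h = "\<lambda>xs ys s. causal_input Q xs (map z ys) * fwd_mass W P0 xs ys s"
  have "(\<Sum>k\<in>K. \<Sum>s\<in>UNIV. occupation W P0 z n Q \<kappa> k s * F k s) =
    (\<Sum>k\<in>K. \<Sum>s\<in>UNIV. \<Sum>xs\<in>blocks n. \<Sum>ys\<in>blocks n.
      if \<kappa> xs (map z ys) = k then ?h xs ys s * F k s else 0)"
    unfolding occupation_def sum_distrib_right by (intro sum.cong refl) auto
  also have "\<dots> = (\<Sum>xs\<in>blocks n. \<Sum>ys\<in>blocks n. \<Sum>k\<in>K. \<Sum>s\<in>UNIV.
      if \<kappa> xs (map z ys) = k then ?h xs ys s * F k s else 0)"
    by (rule sum_swap_pairs)
  also have "\<dots> = (\<Sum>xs\<in>blocks n. \<Sum>ys\<in>blocks n. \<Sum>s\<in>UNIV. ?h xs ys s * F (\<kappa> xs (map z ys)) s)"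
    by (intro sum.cong[OF refl], subst sum.swap) (simp add: assms)
  finally show ?thesis by simp
qed

lemma occupation_nonneg: "0 \<le> occupation W P0 z n Q \<kappa> k s"
  by (auto simp: occupation_def intro!: sum_nonneg mult_nonneg_nonneg causal_input_nonneg fwd_mass_nonneg)

lemma sum_occupation_eq_1:
  assumes "finite K" "\<And>xs zs. \<kappa> xs zs \<in> K"
  shows "(\<Sum>k\<in>K. \<Sum>s\<in>UNIV. occupation W P0 z n Q \<kappa> k s) = 1"
proof -
  have "(\<Sum>k\<in>K. \<Sum>s\<in>UNIV. occupation W P0 z n Q \<kappa> k s) =
    (\<Sum>xs\<in>blocks n. \<Sum>ys\<in>blocks n. \<Sum>s\<in>UNIV. causal_input Q xs (map z ys) * fwd_mass W P0 xs ys s)"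
    using sum_occupation[OF assms, where n = n and Q = Q and ?P0.0 = P0 and F = "\<lambda>_ _. 1"] by simp
  also have "\<dots> = (\<Sum>xs\<in>blocks n. \<Sum>ys\<in>blocks n. path_mass W P0 z Q xs ys)"
    by (intro sum.cong refl) (simp add: path_mass_def chan_eq_sum_fwd_mass blocks_def sum_distrib_left)
  finally show ?thesis by (simp add: sum_path_mass)
qed

lemma occupation_le_1:
  assumes "finite K" "\<And>xs zs. \<kappa> xs zs \<in> K" "k \<in> K"
  shows "occupation W P0 z n Q \<kappa> k s \<le> 1"
proof -
  have "occupation W P0 z n Q \<kappa> k s \<le> (\<Sum>s\<in>UNIV. occupation W P0 z n Q \<kappa> k s)"
    by (intro member_le_sum) (auto simp: occupation_nonneg)
  also have "\<dots> \<le> (\<Sum>k\<in>K. \<Sum>s\<in>UNIV. occupation W P0 z n Q \<kappa> k s)"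
    using assms by (intro member_le_sum[of k K]) (auto intro!: sum_nonneg occupation_nonneg)
  finally show ?thesis by (simp only: sum_occupation_eq_1[OF assms(1,2)])
qed

text \<open>\<open>dirinf_add_ge\<close> for a policy that remembers only the cell of its first n
  steps: the expected gain of the continuation is then a function of the occupation vector.\<close>

lemma dirinf_switch_policy:
  assumes "finite K" "\<And>xs zs. \<kappa> xs zs \<in> K"
  shows "dirinf W P0 z n Q + (\<Sum>k\<in>K. \<Sum>s\<in>UNIV. occupation W P0 z n Q \<kappa> k s *
      dirinf W (return_pmf s) z T (R k)) - log 2 CARD('s)
    \<le> dirinf W P0 z (n + T) (switch_policy n Q \<kappa> R)"
proof -
  let ?Q = "switch_policy n Q \<kappa> R"
  have ci: "causal_input ?Q xs (map z ys) = causal_input Q xs (map z ys)"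
    if "xs \<in> blocks n" "ys \<in> blocks n" for xs ys
    using that by (intro causal_input_cong) (auto simp: blocks_def switch_policy_def)
  have later: "later_policy ?Q xs (map z ys) = R (\<kappa> xs (map z ys))"
    if "xs \<in> blocks n" "ys \<in> blocks n" for xs ys
    using that by (auto simp: blocks_def switch_policy_def)
  have path: "path_mass W P0 z ?Q xs ys = path_mass W P0 z Q xs ys"
    if "xs \<in> blocks n" "ys \<in> blocks n" for xs ys
    using ci[OF that] by (simp add: path_mass_def)
  have out: "out_mass W P0 z ?Q ys = out_mass W P0 z Q ys" if "ys \<in> blocks n" for ys
    using path that by (auto simp: out_mass_def blocks_def[of "length ys"] blocks_def intro!: sum.cong)
  have "dirinf W P0 z n ?Q = dirinf W P0 z n Q"
    unfolding directed_info_joint_law by (intro sum.cong refl) (simp add: path out)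
  moreover have "(\<Sum>k\<in>K. \<Sum>s\<in>UNIV. occupation W P0 z n Q \<kappa> k s * dirinf W (return_pmf s) z T (R k)) =
    (\<Sum>xs\<in>blocks n. \<Sum>ys\<in>blocks n. \<Sum>s\<in>UNIV. causal_input ?Q xs (map z ys) * fwd_mass W P0 xs ys s *
      dirinf W (return_pmf s) z T (later_policy ?Q xs (map z ys)))"
    unfolding sum_occupation[OF assms, symmetric]
    by (intro sum.cong refl) (simp only: ci later)
  ultimately show ?thesis using dirinf_add_ge[where W = W and ?P0.0 = P0 and z = z and n = n and Q = ?Q and T = T] by simp
qed

text \<open>From above, \<open>chan_from\<close> is at most 1 and r is not too small. From below, r
  is at most 1 and the causally conditioned output entropy is at most
  \<open>T log |Y|\<close>.\<close>

lemma abs_cross_information_le: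
  assumes r: "\<And>ys. ys \<in> blocks T \<Longrightarrow> 1 / (2 * real CARD('y) ^ T) \<le> r ys"
    "\<And>ys. ys \<in> blocks T \<Longrightarrow> r ys \<le> 1"
  shows "\<bar>\<Sum>xs\<in>blocks T. \<Sum>ys\<in>blocks T. path_mass W (return_pmf s) z Q xs ys *
     (log 2 (chan_from W s xs ys) - log 2 (r ys))\<bar> \<le> 1 + real T * log 2 CARD('y)"
proof -
  let ?l = "real T * log 2 CARD('y)"
  let ?p = "path_mass W (return_pmf s) z Q"
  have r0: "0 < r ys" if "ys \<in> blocks T" for ys
    using r(1)[OF that] by (rule less_le_trans[rotated]) simp
  have lr: "- log 2 (r ys) \<le> 1 + ?l" "0 \<le> - log 2 (r ys)" if "ys \<in> blocks T" for ys
  proof -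
    have "log 2 (1 / (2 * real CARD('y) ^ T)) \<le> log 2 (r ys)"
      using r(1)[OF that] by (intro log_mono) auto
    thus "- log 2 (r ys) \<le> 1 + ?l" by (simp add: log_divide log_mult log_nat_power)
    show "0 \<le> - log 2 (r ys)" using r(2)[OF that] r0[OF that] by simp
  qed
  \<comment> \<open>Where \<open>chan_from\<close> vanishes its logarithm has the default value 0,
    which obeys the bound.\<close>
  have lc: "log 2 (chan_from W s xs ys) \<le> 0" if "xs \<in> blocks T" "ys \<in> blocks T" for xs ys
  proof (cases "chan_from W s xs ys = 0")
    case False
    thus ?thesis using chan_from_le_1[of ys xs W s] chan_from_nonneg[of W s xs ys] that
      by (simp add: blocks_def less_le)
  qed (simp add: log_def)
  have "(\<Sum>xs\<in>blocks T. \<Sum>ys\<in>blocks T. ?p xs ys * (log 2 (chan_from W s xs ys) - log 2 (r ys)))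
    \<le> (\<Sum>xs\<in>blocks T. \<Sum>ys\<in>blocks T. ?p xs ys * (1 + ?l))"
    using lc lr(1) by (intro sum_mono mult_left_mono path_mass_nonneg) (smt (verit))
  also have "\<dots> = 1 + ?l" by (simp only: sum_distrib_right[symmetric] sum_path_mass mult_1)
  finally have up: "(\<Sum>xs\<in>blocks T. \<Sum>ys\<in>blocks T. ?p xs ys * (log 2 (chan_from W s xs ys) - log 2 (r ys))) \<le> 1 + ?l" .
  have "- ?l \<le> (\<Sum>xs\<in>blocks T. \<Sum>ys\<in>blocks T. ?p xs ys * log 2 (chan_from W s xs ys))"
    using sum_path_mass_mult_log_chan[of T W "return_pmf s" z Q] by (simp only: chan_return)
  also have "\<dots> \<le> (\<Sum>xs\<in>blocks T. \<Sum>ys\<in>blocks T. ?p xs ys * (log 2 (chan_from W s xs ys) - log 2 (r ys)))"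
    using lr(2) by (intro sum_mono mult_left_mono path_mass_nonneg) simp
  finally show ?thesis using up by linarith
qed

text \<open>A test law that is at least half the true output law costs at most one bit.\<close>

lemma cross_information_le_dirinf:
  assumes r: "\<And>ys. ys \<in> blocks T \<Longrightarrow> out_mass W (return_pmf s) z Q ys / 2 \<le> r ys"
  shows "(\<Sum>xs\<in>blocks T. \<Sum>ys\<in>blocks T. path_mass W (return_pmf s) z Q xs ys *
     (log 2 (chan_from W s xs ys) - log 2 (r ys))) \<le> dirinf W (return_pmf s) z T Q + 1"
proof -
  let ?p = "path_mass W (return_pmf s) z Q" and ?o = "out_mass W (return_pmf s) z Q"
  have "(\<Sum>xs\<in>blocks T. \<Sum>ys\<in>blocks T. ?p xs ys * (log 2 (chan_from W s xs ys) - log 2 (r ys)))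
    \<le> (\<Sum>xs\<in>blocks T. \<Sum>ys\<in>blocks T. ?p xs ys * (log 2 (chan_from W s xs ys / ?o ys) + 1))"
  proof (intro sum_mono)
    fix xs :: "'x list" and ys :: "'y list" assume *: "xs \<in> blocks T" "ys \<in> blocks T"
    show "?p xs ys * (log 2 (chan_from W s xs ys) - log 2 (r ys)) \<le>
      ?p xs ys * (log 2 (chan_from W s xs ys / ?o ys) + 1)"
    proof (cases "?p xs ys = 0")
      case False
      hence "0 < ?p xs ys" using path_mass_nonneg[of W "return_pmf s" z Q xs ys] by simp
      hence pos: "0 < chan_from W s xs ys" "0 < ?o ys"
        using path_mass_pos[of W "return_pmf s" z Q xs ys] * by (auto simp: chan_return blocks_def)
      have "log 2 (?o ys / 2) \<le> log 2 (r ys)"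
        using r[OF *(2)] pos by (intro log_mono) auto
      thus ?thesis using pos by (intro mult_left_mono path_mass_nonneg) (simp add: log_divide)
    qed simp
  qed
  also have "\<dots> = dirinf W (return_pmf s) z T Q + 1"
    by (simp only: directed_info_joint_law chan_return distrib_left sum.distrib mult_1_right sum_path_mass)
  finally show ?thesis .
qed

lemma sum_blocks_map:
  "(\<Sum>ys\<in>blocks n. f ys (map z ys)) = (\<Sum>zs\<in>blocks n. \<Sum>ys | ys \<in> blocks n \<and> map z ys = zs. f ys zs :: real)"
proof -
  have "(\<Sum>ys\<in>blocks n. f ys (map z ys)) =
    (\<Sum>zs\<in>blocks n. \<Sum>ys | ys \<in> blocks n \<and> map z ys = zs. f ys (map z ys))"
    by (rule sum.group[symmetric]) (auto simp: map_in_blocks)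
  thus ?thesis by (auto intro: sum.cong)
qed

text \<open>\<open>\<kappa>\<close> rounds the encoder's belief \<open>P(s_n | x^n, z^n)\<close> down to multiples of \<open>1 / M\<close>. The test laws average
  the output law of \<open>R k\<close> with the uniform law, which keeps the log-likelihood ratios of order \<open>T\<close>.\<close>

lemma dirinf_diff_quantised:
  assumes M: "0 < M"
  obtains \<kappa> :: "'x list \<Rightarrow> 'z list \<Rightarrow> 's \<Rightarrow> nat" and R :: "('s \<Rightarrow> nat) \<Rightarrow> ('x, 'z) input_policy"
  where "\<And>xs zs. \<kappa> xs zs \<in> levels M"
    and "dirinf W P0 z (n + T) Q - dirinf W P0 z n Q \<le>
      (\<Sum>k\<in>levels M. \<Sum>s\<in>UNIV. occupation W P0 z n Q \<kappa> k s * dirinf W (return_pmf s) z T (R k)) +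
      (log 2 (card (levels M :: ('s \<Rightarrow> nat) set) * CARD('s)) + 1 +
       2 * (1 + real T * log 2 CARD('y)) * CARD('s) / M)"
proof -
  let ?U = "(blocks n :: 'x list set) \<times> (blocks n :: 'z list set)"
  let ?K = "levels M :: ('s \<Rightarrow> nat) set"
  \<comment> \<open>P(x^n, z^n, s_n = s). The encoder sees outputs through z only, so its belief
    \<open>\<rho> u s / \<mu> u\<close> sums over all outputs with the given feedback.\<close>
  define \<rho> where "\<rho> u s = (case u of (xs, zs) \<Rightarrow>
    causal_input Q xs zs * (\<Sum>ys | ys \<in> blocks n \<and> map z ys = zs. fwd_mass W P0 xs ys s))" for u s
  define \<mu> where "\<mu> u = (\<Sum>s\<in>UNIV. \<rho> u s)" for u
  define \<kappa> where "\<kappa> xs zs s = nat \<lfloor>real M * \<rho> (xs, zs) s / \<mu> (xs, zs)\<rfloor>" for xs zs s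
  define \<kappa>' where "\<kappa>' u = \<kappa> (fst u) (snd u)" for u
  have \<rho>0: "0 \<le> \<rho> u s" for u s
    by (auto simp: \<rho>_def split: prod.split intro!: mult_nonneg_nonneg causal_input_nonneg sum_nonneg fwd_mass_nonneg)
  have \<rho>\<mu>: "\<rho> u s \<le> \<mu> u" for u s
    unfolding \<mu>_def by (rule member_le_sum) (auto simp: \<rho>0)
  have \<mu>0: "0 \<le> \<mu> u" for u by (simp add: \<mu>_def sum_nonneg \<rho>0)
  have \<kappa>K: "\<kappa> xs zs \<in> ?K" for xs zs
    using nat_floor_approx(1)[OF \<rho>0 \<rho>\<mu> M] by (auto simp: levels_def \<kappa>_def)
  have quant: "\<bar>\<rho> u s - real (\<kappa>' u s) / real M * \<mu> u\<bar> \<le> 1 / real M * \<mu> u" for u s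
    using nat_floor_approx(2)[OF \<rho>0 \<rho>\<mu> M, of u s] by (simp add: \<kappa>'_def \<kappa>_def)
  define L where "L u = later_policy Q (fst u) (snd u)" for u
  \<comment> \<open>The continuations of a cell are mixed with weights that do not involve the
    state, so \<open>mean\<close> below holds for every s with the same \<open>R k\<close>.\<close>
  have "\<exists>R. \<forall>k xs zs. length zs = length xs \<longrightarrow>
    (\<Sum>u | u \<in> ?U \<and> \<kappa>' u = k. \<mu> u) * causal_input (R k) xs zs =
      (\<Sum>u | u \<in> ?U \<and> \<kappa>' u = k. \<mu> u * causal_input (L u) xs zs)"
    by (rule choice, rule allI, rule exists_mixture_policy) (auto simp: \<mu>0)
  then obtain R where R: "\<And>k xs zs. length zs = length xs \<Longrightarrow>
    (\<Sum>u | u \<in> ?U \<and> \<kappa>' u = k. \<mu> u) * causal_input (R k) xs zs =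
      (\<Sum>u | u \<in> ?U \<and> \<kappa>' u = k. \<mu> u * causal_input (L u) xs zs)"
    by blast
  let ?Y = "1 / real CARD('y) ^ T"
  define r where "r k s ys = (out_mass W (return_pmf s) z (R k) ys + ?Y) / 2" for k s ys
  have r1: "1 / (2 * real CARD('y) ^ T) \<le> r k s ys" for k s ys
    by (simp add: r_def field_simps out_mass_nonneg)
  have r2: "r k s ys \<le> 1" for k s ys
  proof -
    have "?Y \<le> 1" by (simp add: one_le_power Suc_leI)
    hence "out_mass W (return_pmf s) z (R k) ys + ?Y \<le> 1 + 1"
      by (intro add_mono out_mass_le_1)
    hence "(out_mass W (return_pmf s) z (R k) ys + ?Y) / 2 \<le> (1 + 1) / 2"
      by (rule divide_right_mono) simp
    thus ?thesis by (simp only: r_def) simp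
  qed
  have r3: "out_mass W (return_pmf s) z (R k) ys / 2 \<le> r k s ys" for k s ys
    by (simp add: r_def)
  have r0: "0 < r k s ys" for k s ys
    using r1[of k s ys] by (rule less_le_trans[rotated]) simp
  have r_sum: "(\<Sum>ys\<in>blocks T. r k s ys) \<le> 1" for k s
    unfolding r_def sum_divide_distrib[where r = "2::real", symmetric] sum.distrib
    by (simp only: sum_out_mass inverse_card_power) simp
  \<comment> \<open>With the test law fixed, this is linear in the causal input mass of P, unlike
    directed information, whose output law moves with P. Hence the mixture \<open>R k\<close>
    averages it exactly.\<close>
  define \<Phi> where "\<Phi> P k s = (\<Sum>xs\<in>blocks T. \<Sum>ys\<in>blocks T. path_mass W (return_pmf s) z P xs ys *
     (log 2 (chan_from W s xs ys) - log 2 (r k s ys)))" for P k s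
  have \<Phi>_le: "\<bar>\<Phi> P k s\<bar> \<le> 1 + real T * log 2 CARD('y)" for P k s
    unfolding \<Phi>_def by (intro abs_cross_information_le r1 r2)
  have mean: "(\<Sum>u | u \<in> ?U \<and> \<kappa>' u = k. \<mu> u * \<Phi> (L u) (\<kappa>' u) s) =
    (\<Sum>u | u \<in> ?U \<and> \<kappa>' u = k. \<mu> u) * \<Phi> (R k) k s" for k s
  proof -
    let ?J = "{u. u \<in> ?U \<and> \<kappa>' u = k}"
    let ?h = "\<lambda>xs ys. chan_from W s xs ys * (log 2 (chan_from W s xs ys) - log 2 (r k s ys))"
    have "(\<Sum>u\<in>?J. \<mu> u * \<Phi> (L u) (\<kappa>' u) s) = (\<Sum>u\<in>?J. \<Sum>xs\<in>blocks T. \<Sum>ys\<in>blocks T.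
        \<mu> u * causal_input (L u) xs (map z ys) * ?h xs ys)"
      unfolding \<Phi>_def path_mass_def chan_return sum_distrib_left
      by (intro sum.cong refl) (simp add: mult.assoc)
    also have "\<dots> = (\<Sum>xs\<in>blocks T. \<Sum>ys\<in>blocks T.
        (\<Sum>u\<in>?J. \<mu> u * causal_input (L u) xs (map z ys)) * ?h xs ys)"
      unfolding sum_distrib_right by (subst sum.swap) (intro sum.cong refl sum.swap)
    also have "\<dots> = (\<Sum>xs\<in>blocks T. \<Sum>ys\<in>blocks T.
        (\<Sum>u\<in>?J. \<mu> u) * causal_input (R k) xs (map z ys) * ?h xs ys)"
    proof (intro sum.cong refl)
      fix xs :: "'x list" and ys :: "'y list" assume "xs \<in> blocks T" "ys \<in> blocks T"
      hence "length (map z ys) = length xs" by (simp add: blocks_def)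
      from R[OF this] show "(\<Sum>u\<in>?J. \<mu> u * causal_input (L u) xs (map z ys)) * ?h xs ys =
        (\<Sum>u\<in>?J. \<mu> u) * causal_input (R k) xs (map z ys) * ?h xs ys" by simp
    qed
    also have "\<dots> = (\<Sum>u\<in>?J. \<mu> u) * \<Phi> (R k) k s"
      unfolding \<Phi>_def path_mass_def chan_return sum_distrib_left
      by (intro sum.cong refl) (simp add: mult.assoc)
    finally show ?thesis .
  qed
  have \<mu>_sum: "sum \<mu> ?U = 1"
  proof -
    have "sum \<mu> ?U = (\<Sum>xs\<in>blocks n. \<Sum>zs\<in>blocks n. \<Sum>ys | ys \<in> blocks n \<and> map z ys = zs.
        causal_input Q xs zs * chan W P0 xs ys)"
      unfolding sum.cartesian_product'
    proof (intro sum.cong refl)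
      fix xs :: "'x list" and zs :: "'z list" assume "xs \<in> blocks n"
      thus "\<mu> (xs, zs) = (\<Sum>ys | ys \<in> blocks n \<and> map z ys = zs. causal_input Q xs zs * chan W P0 xs ys)"
        unfolding \<mu>_def \<rho>_def prod.case sum_distrib_left
        by (subst sum.swap) (auto intro!: sum.cong simp: chan_eq_sum_fwd_mass blocks_def sum_distrib_left)
    qed
    also have "\<dots> = (\<Sum>xs\<in>blocks n. \<Sum>ys\<in>blocks n. path_mass W P0 z Q xs ys)"
      unfolding path_mass_def by (intro sum.cong refl) (rule sum_blocks_map[symmetric])
    finally show ?thesis by (simp only: sum_path_mass)
  qed
  have regroup: "(\<Sum>xs\<in>blocks n. \<Sum>ys\<in>blocks n. \<Sum>s\<in>UNIV.
      causal_input Q xs (map z ys) * fwd_mass W P0 xs ys s * F (xs, map z ys) s) =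
    (\<Sum>u\<in>?U. \<Sum>s\<in>UNIV. \<rho> u s * F u s)" for F :: "'x list \<times> 'z list \<Rightarrow> 's \<Rightarrow> real"
  proof -
    have "(\<Sum>xs\<in>blocks n. \<Sum>ys\<in>blocks n. \<Sum>s\<in>UNIV.
      causal_input Q xs (map z ys) * fwd_mass W P0 xs ys s * F (xs, map z ys) s) =
      (\<Sum>xs\<in>blocks n. \<Sum>zs\<in>blocks n. \<Sum>ys | ys \<in> blocks n \<and> map z ys = zs. \<Sum>s\<in>UNIV.
        causal_input Q xs zs * fwd_mass W P0 xs ys s * F (xs, zs) s)"
      by (intro sum.cong refl) (rule sum_blocks_map)
    also have "\<dots> = (\<Sum>xs\<in>blocks n. \<Sum>zs\<in>blocks n. \<Sum>s\<in>UNIV. \<rho> (xs, zs) s * F (xs, zs) s)"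
      unfolding \<rho>_def prod.case sum_distrib_left sum_distrib_right by (intro sum.cong refl sum.swap)
    finally show ?thesis by (simp only: sum.cartesian_product')
  qed
  have "dirinf W P0 z (n + T) Q - dirinf W P0 z n Q \<le>
    (\<Sum>xs\<in>blocks n. \<Sum>ys\<in>blocks n. \<Sum>s\<in>UNIV. causal_input Q xs (map z ys) * fwd_mass W P0 xs ys s *
      \<Phi> (L (xs, map z ys)) (\<kappa>' (xs, map z ys)) s) + log 2 (card ?K * CARD('s))"
    using dirinf_diff_le[OF finite_levels \<kappa>K r0 r_sum, where W = W and ?P0.0 = P0 and z = z and n = n and Q = Q]
    by (simp only: \<Phi>_def L_def \<kappa>'_def fst_conv snd_conv)
  also have "(\<Sum>xs\<in>blocks n. \<Sum>ys\<in>blocks n. \<Sum>s\<in>UNIV. causal_input Q xs (map z ys) * fwd_mass W P0 xs ys s *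
      \<Phi> (L (xs, map z ys)) (\<kappa>' (xs, map z ys)) s) = (\<Sum>u\<in>?U. \<Sum>s\<in>UNIV. \<rho> u s * \<Phi> (L u) (\<kappa>' u) s)"
    by (rule regroup)
  also have "\<dots> \<le> (\<Sum>k\<in>?K. \<Sum>s\<in>UNIV. (\<Sum>u | u \<in> ?U \<and> \<kappa>' u = k. \<rho> u s) * \<Phi> (R k) k s) +
      2 * (1 + real T * log 2 CARD('y)) * (1 / real M) * CARD('s) * sum \<mu> ?U"
    by (rule quantised_sum_le[where \<beta> = "\<lambda>k s. real (k s) / real M"])
      (use finite_levels \<kappa>K quant mean \<Phi>_le in \<open>auto simp: \<kappa>'_def\<close>)
  also have "(\<Sum>k\<in>?K. \<Sum>s\<in>UNIV. (\<Sum>u | u \<in> ?U \<and> \<kappa>' u = k. \<rho> u s) * \<Phi> (R k) k s) =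
    (\<Sum>k\<in>?K. \<Sum>s\<in>UNIV. occupation W P0 z n Q \<kappa> k s * \<Phi> (R k) k s)"
  proof -
    have "(\<Sum>k\<in>?K. \<Sum>s\<in>UNIV. (\<Sum>u | u \<in> ?U \<and> \<kappa>' u = k. \<rho> u s) * \<Phi> (R k) k s) =
      (\<Sum>k\<in>?K. \<Sum>u | u \<in> ?U \<and> \<kappa>' u = k. \<Sum>s\<in>UNIV. \<rho> u s * \<Phi> (R (\<kappa>' u)) (\<kappa>' u) s)"
      unfolding sum_distrib_right by (intro sum.cong[OF refl], subst sum.swap) (auto intro!: sum.cong)
    also have "\<dots> = (\<Sum>u\<in>?U. \<Sum>s\<in>UNIV. \<rho> u s * \<Phi> (R (\<kappa>' u)) (\<kappa>' u) s)"
      by (rule sum.group) (use finite_levels \<kappa>K in \<open>auto simp: \<kappa>'_def\<close>)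
    finally show ?thesis
      unfolding regroup[symmetric] sum_occupation[OF finite_levels \<kappa>K, symmetric]
      by (simp only: \<kappa>'_def fst_conv snd_conv)
  qed
  also have "\<dots> \<le> (\<Sum>k\<in>?K. \<Sum>s\<in>UNIV. occupation W P0 z n Q \<kappa> k s * (dirinf W (return_pmf s) z T (R k) + 1))"
    unfolding \<Phi>_def by (intro sum_mono mult_left_mono occupation_nonneg cross_information_le_dirinf r3)
  also have "\<dots> = (\<Sum>k\<in>?K. \<Sum>s\<in>UNIV. occupation W P0 z n Q \<kappa> k s * dirinf W (return_pmf s) z T (R k)) + 1"
    by (simp only: distrib_left sum.distrib mult_1_right sum_occupation_eq_1[OF finite_levels \<kappa>K])
  finally have "dirinf W P0 z (n + T) Q - dirinf W P0 z n Q \<le>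
      (\<Sum>k\<in>?K. \<Sum>s\<in>UNIV. occupation W P0 z n Q \<kappa> k s * dirinf W (return_pmf s) z T (R k)) +
      (log 2 (card ?K * CARD('s)) + 1 + 2 * (1 + real T * log 2 CARD('y)) * CARD('s) / M)"
    by (simp add: \<mu>_sum)
  thus ?thesis using that \<kappa>K by blast
qed

end

section \<open>The limit and the converse\<close>

text \<open>Dividing \<open>blk\<close> by N shows that, up to e and vanishing terms, a N / N is for
  large N at most a (n0 + T) / T, for each fixed T. Let L be a subsequential limit. A suitable n0 +
  T in the subsequence bounds all large N above by about L; N running through the subsequence bounds
  every large T below by about L.\<close>

lemma convergent_average:
  fixes a :: "nat \<Rightarrow> real"
  assumes a0: "\<And>N. 0 \<le> a N" and al: "\<And>N. a N \<le> real N * l"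
    and blk: "\<And>e. 0 < e \<Longrightarrow> \<exists>n0 C. \<forall>T N. 0 < T \<longrightarrow>
      a N \<le> real T * l + real (N div T) * (a (n0 + T) + C + e * real T)"
  shows "convergent (\<lambda>N. 1 / real N * a N)"
proof -
  define x where "x N = 1 / real N * a N" for N
  have x0: "0 \<le> x N" for N using a0 by (simp add: x_def)
  have l0: "0 \<le> l" using a0[of 1] al[of 1] by simp
  have xl: "x N \<le> l" for N
    using al[of N] l0 by (cases "N = 0") (simp_all add: x_def divide_le_eq mult.commute)
  have "bounded (range x)"
    using x0 xl by (intro boundedI[of _ l]) auto
  then obtain L r where r: "strict_mono r" and lim: "(x \<circ> r) \<longlonglongrightarrow> L"
    using bounded_imp_convergent_subsequence by blast
  have r_top: "filterlim r at_top sequentially" by (rule filterlim_subseq[OF r])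
  have "x \<longlonglongrightarrow> L"
  proof (rule tendstoI)
    fix e' :: real assume "0 < e'"
    define e where "e = e' / 3"
    have e: "0 < e" using \<open>0 < e'\<close> by (simp add: e_def)
    from blk[OF e] obtain n0 C where blk': "\<And>T N. 0 < T \<Longrightarrow>
      a N \<le> real T * l + real (N div T) * (a (n0 + T) + C + e * real T)" by blast
    \<comment> \<open>C may be negative; its absolute value keeps the bracket nonnegative, so that
      \<open>N div T\<close> may be enlarged to N / T.\<close>
    define H where "H T = (a (n0 + T) + \<bar>C\<bar>) / real T + e" for T
    have xH: "x N \<le> real T * l / real N + H T" if "0 < T" "0 < N" for T N
    proof -
      have "real (N div T) * (a (n0 + T) + C + e * real T) \<le>
        (real N / real T) * (a (n0 + T) + \<bar>C\<bar> + e * real T)"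
        using a0[of "n0 + T"] e
        by (intro order_trans[OF mult_left_mono mult_right_mono] of_nat_div_le_of_nat) auto
      hence "a N \<le> real T * l + (real N / real T) * (a (n0 + T) + \<bar>C\<bar> + e * real T)"
        using blk'[OF that(1), of N] by linarith
      hence "a N / real N \<le> (real T * l + (real N / real T) * (a (n0 + T) + \<bar>C\<bar> + e * real T)) / real N"
        by (rule divide_right_mono) simp
      also have "\<dots> = real T * l / real N + H T"
        using that by (simp add: H_def field_simps)
      finally show ?thesis by (simp add: x_def)
    qed
    have tail: "(\<lambda>N. real T * l / real N) \<longlonglongrightarrow> 0" for T
      by (intro real_tendsto_divide_at_top[OF tendsto_const] filterlim_real_sequentially)
    \<comment> \<open>N runs through the subsequence, T is fixed.\<close>
    have LH: "L \<le> H T" if "0 < T" for T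
    proof (rule LIMSEQ_le[OF lim])
      have "(\<lambda>j. real T * l / real (r j)) \<longlonglongrightarrow> 0"
        using filterlim_compose[OF tail r_top] .
      thus "(\<lambda>j. real T * l / real (r j) + H T) \<longlonglongrightarrow> H T"
        using tendsto_add[OF _ tendsto_const] by fastforce
      have "x (r j) \<le> real T * l / real (r j) + H T" if "1 \<le> j" for j
        using xH[OF \<open>0 < T\<close>, of "r j"] seq_suble[OF r, of j] that by linarith
      thus "\<exists>N. \<forall>j\<ge>N. (x \<circ> r) j \<le> real T * l / real (r j) + H T" by auto
    qed
    have "\<forall>\<^sub>F N in sequentially. x N < L + 3 * e"
    proof -
      have "filterlim (\<lambda>N. - real n0 + real N) at_top sequentially"
        by (rule filterlim_tendsto_add_at_top[OF tendsto_const filterlim_real_sequentially])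
      hence quot: "(\<lambda>N. k / (real N - real n0)) \<longlonglongrightarrow> 0" for k
        by (intro real_tendsto_divide_at_top[OF tendsto_const]) simp
      have "(\<lambda>j. x (r j) * (1 + real n0 / (real (r j) - real n0)) + \<bar>C\<bar> / (real (r j) - real n0) + e) \<longlonglongrightarrow> L * (1 + 0) + 0 + e"
        using lim by (intro tendsto_intros filterlim_compose[OF quot r_top]) (simp add: o_def)
      hence "\<forall>\<^sub>F j in sequentially. x (r j) * (1 + real n0 / (real (r j) - real n0)) + \<bar>C\<bar> / (real (r j) - real n0) + e < L + 2 * e"
        using e by (intro order_tendstoD(2)) auto
      moreover have "\<forall>\<^sub>F j in sequentially. n0 < r j"
        by (rule eventually_compose_filterlim[OF eventually_gt_at_top r_top])
      ultimately have "\<forall>\<^sub>F j in sequentially. n0 < r j \<and>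
        x (r j) * (1 + real n0 / (real (r j) - real n0)) + \<bar>C\<bar> / (real (r j) - real n0) + e < L + 2 * e"
        by eventually_elim auto
      then obtain j where j: "n0 < r j"
        "x (r j) * (1 + real n0 / (real (r j) - real n0)) + \<bar>C\<bar> / (real (r j) - real n0) + e < L + 2 * e"
        using eventually_happens trivial_limit_sequentially by blast
      \<comment> \<open>Chosen so that n0 + T is a member of the subsequence.\<close>
      define T where "T = r j - n0"
      have T: "0 < T" "real T = real (r j) - real n0" "n0 + T = r j" using j(1) by (auto simp: T_def)
      have "H T = x (r j) * (1 + real n0 / (real (r j) - real n0)) + \<bar>C\<bar> / (real (r j) - real n0) + e"
      proof -
        have "1 + real n0 / (real (r j) - real n0) = real (r j) / (real (r j) - real n0)"
          using j(1) by (simp add: field_simps)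
        thus ?thesis using j(1) by (simp add: H_def T x_def add_divide_distrib)
      qed
      hence HT: "H T < L + 2 * e" using j(2) by simp
      have "\<forall>\<^sub>F N in sequentially. real T * l / real N < e"
        using tail e by (intro order_tendstoD(2)) auto
      with eventually_gt_at_top[of 0] show ?thesis
      proof eventually_elim
        case (elim N)
        thus ?case using xH[OF T(1), of N] HT by linarith
      qed
    qed
    moreover have "\<forall>\<^sub>F N in sequentially. L - 3 * e < x N"
    proof -
      have "(\<lambda>N. (L - e) - (real n0 * (L - e) + \<bar>C\<bar>) / real N) \<longlonglongrightarrow> (L - e) - 0"
        by (intro tendsto_intros real_tendsto_divide_at_top[OF tendsto_const] filterlim_real_sequentially)
      hence "\<forall>\<^sub>F N in sequentially. L - 3 * e < (L - e) - (real n0 * (L - e) + \<bar>C\<bar>) / real N"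
        using e by (intro order_tendstoD(1)) auto
      with eventually_gt_at_top[of n0] show ?thesis
      proof eventually_elim
        case (elim N)
        \<comment> \<open>Now n0 + T is an arbitrary large N, and \<open>LH\<close> bounds it from
          below.\<close>
        define T where "T = N - n0"
        have T: "0 < T" "real T = real N - real n0" "n0 + T = N" using elim by (auto simp: T_def)
        have "L - e \<le> (a N + \<bar>C\<bar>) / real T" using LH[OF T(1)] by (simp add: H_def T(3))
        hence "(L - e) * real T \<le> a N + \<bar>C\<bar>" using T(1) by (simp add: le_divide_eq)
        hence "((real N - real n0) * (L - e) - \<bar>C\<bar>) / real N \<le> x N"
          unfolding x_def T(2)[symmetric] by (simp add: divide_right_mono mult.commute)
        moreover have "((real N - real n0) * (L - e) - \<bar>C\<bar>) / real N = (L - e) - (real n0 * (L - e) + \<bar>C\<bar>) / real N"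
          using elim by (simp add: field_simps)
        ultimately show ?case using elim by linarith
      qed
    qed
    ultimately show "\<forall>\<^sub>F N in sequentially. dist (x N) L < e'"
      by eventually_elim (auto simp: dist_real_def e_def abs_if)
  qed
  thus ?thesis unfolding convergent_def x_def by blast
qed

section \<open>Convergence of the normalised maximal directed information\<close>

context
  fixes W :: "'x::finite \<Rightarrow> 's::finite \<Rightarrow> ('y::finite \<times> 's) pmf"
    and P0 :: "'s pmf"
    and z :: "'y \<Rightarrow> 'z::finite"
begin

private abbreviation (input) "a \<equiv> max_directed_info W P0 z"

lemma dirinf_le_max: "dirinf W P0 z N Q \<le> a N"
  unfolding max_directed_info_def
  by (rule cSUP_upper[OF UNIV_I bdd_aboveI2[OF dirinf_le]])

lemma max_directed_info_leI: "(\<And>Q. dirinf W P0 z N Q \<le> b) \<Longrightarrow> a N \<le> b"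
  unfolding max_directed_info_def by (rule cSUP_least) auto

lemma max_directed_info_nonneg: "0 \<le> a N"
  using dirinf_nonneg dirinf_le_max order_trans by blast

lemma max_directed_info_le: "a N \<le> real N * log 2 CARD('y)"
  by (intro max_directed_info_leI dirinf_le)

text \<open>Monotonicity up to a constant, which disappears after division by N.\<close>

lemma max_directed_info_add_ge: "a n \<le> a (n + T) + log 2 CARD('s)"
proof (rule max_directed_info_leI)
  fix Q :: "('x, 'z) input_policy"
  \<comment> \<open>With a single cell the switch merely restarts some policy after n steps; any
    would do, as its information is nonnegative.\<close>
  let ?Q = "switch_policy n Q (\<lambda>_ _. ()) (\<lambda>_. Q)"
  have "0 \<le> (\<Sum>k\<in>{()}. \<Sum>s\<in>UNIV. occupation W P0 z n Q (\<lambda>_ _. ()) k s * dirinf W (return_pmf s) z T Q)"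
    by (intro sum_nonneg mult_nonneg_nonneg occupation_nonneg dirinf_nonneg)
  moreover have "dirinf W P0 z n Q + (\<Sum>k\<in>{()}. \<Sum>s\<in>UNIV. occupation W P0 z n Q (\<lambda>_ _. ()) k s *
      dirinf W (return_pmf s) z T Q) - log 2 CARD('s) \<le> dirinf W P0 z (n + T) ?Q"
    by (rule dirinf_switch_policy) auto
  ultimately show "dirinf W P0 z n Q \<le> a (n + T) + log 2 CARD('s)"
    using dirinf_le_max[of "n + T" ?Q] by linarith
qed

text \<open>By \<open>dirinf_diff_quantised\<close> the continuations \<open>R k\<close> enter
  weighted by an occupation vector. An earlier policy with nearly the same vector can switch to the
  same \<open>R k\<close>. Finitely many rounding classes need finitely many starting times, chosen
  before T; n0 is the largest.\<close>

lemma dirinf_increment_le: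
  assumes e: "0 < e"
  shows "\<exists>n0 C. \<forall>T n Q. dirinf W P0 z (n + T) Q - dirinf W P0 z n Q \<le> a (n0 + T) + C + e * real T"
proof -
  define l where "l = log 2 CARD('y)"
  have l0: "0 \<le> l" by (simp add: l_def Suc_leI)
  \<comment> \<open>Rounding beliefs costs \<open>2 * l * CARD('s) / M\<close> per step, at most e /
    2 by this choice (fact \<open>5\<close>). Likewise D lets the rounding of occupation vectors
    cost at most e / 2 per step (fact \<open>2\<close>).\<close>
  obtain M where M: "4 * l * CARD('s) / e < real M" using reals_Archimedean2 by blast
  have M0: "0 < M" using l0 e le_less_trans[OF _ M, of 0] by simp
  let ?K = "levels M :: ('s \<Rightarrow> nat) set"
  obtain D where D: "2 * card ?K * CARD('s) * l / e < real D" using reals_Archimedean2 by blast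
  have D0: "0 < D" using l0 e le_less_trans[OF _ D, of 0] by simp
  \<comment> \<open>Pigeonhole: occupation vectors with equal roundings \<open>sig\<close> are interchangeable up to \<open>1 / D\<close>.\<close>
  define sig where "sig n Q \<kappa> = (\<lambda>(k, s). if k \<in> ?K then nat \<lfloor>real D * occupation W P0 z n Q \<kappa> k s\<rfloor> else 0)"
    for n and Q :: "('x, 'z) input_policy" and \<kappa>
  define Sigs where "Sigs = {\<sigma>. \<exists>n Q \<kappa>. (\<forall>xs zs. \<kappa> xs zs \<in> ?K) \<and> sig n Q \<kappa> = \<sigma>}"
  have "finite Sigs"
  proof (rule finite_subset)
    show "Sigs \<subseteq> {f. \<forall>p. (p \<in> ?K \<times> UNIV \<longrightarrow> f p \<in> {..D}) \<and> (p \<notin> ?K \<times> UNIV \<longrightarrow> f p = 0)}"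
    proof clarify
      fix \<sigma> k s assume "\<sigma> \<in> Sigs"
      then obtain n Q \<kappa> where *: "\<And>xs zs. \<kappa> xs zs \<in> ?K" and \<sigma>: "sig n Q \<kappa> = \<sigma>" by (auto simp: Sigs_def)
      have "nat \<lfloor>real D * occupation W P0 z n Q \<kappa> k s\<rfloor> \<le> D" if "k \<in> ?K"
      proof -
        have "real D * occupation W P0 z n Q \<kappa> k s \<le> real D * 1"
          using occupation_le_1[OF finite_levels * that] by (intro mult_left_mono) auto
        thus ?thesis by linarith
      qed
      thus "((k, s) \<in> ?K \<times> UNIV \<longrightarrow> \<sigma> (k, s) \<in> {..D}) \<and> ((k, s) \<notin> ?K \<times> UNIV \<longrightarrow> \<sigma> (k, s) = 0)"
        by (auto simp: \<sigma>[symmetric] sig_def)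
    qed
    show "finite {f :: ('s \<Rightarrow> nat) \<times> 's \<Rightarrow> nat. \<forall>p. (p \<in> ?K \<times> UNIV \<longrightarrow> f p \<in> {..D}) \<and> (p \<notin> ?K \<times> UNIV \<longrightarrow> f p = 0)}"
      by (rule finite_set_of_finite_funs) (auto simp: finite_levels)
  qed
  have "\<forall>\<sigma>\<in>Sigs. \<exists>n. \<exists>Q \<kappa>. (\<forall>xs zs. \<kappa> xs zs \<in> ?K) \<and> sig n Q \<kappa> = \<sigma>" by (auto simp: Sigs_def)
  from bchoice[OF this] obtain rep where
    rep: "\<And>\<sigma>. \<sigma> \<in> Sigs \<Longrightarrow> \<exists>Q \<kappa>. (\<forall>xs zs. \<kappa> xs zs \<in> ?K) \<and> sig (rep \<sigma>) Q \<kappa> = \<sigma>"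
    by blast
  define n0 where "n0 = Max (rep ` Sigs)"
  \<comment> \<open>One \<open>log 2 CARD('s)\<close> pays for the switch at n', the other for
    passing from n' + T to n0 + T. The rest is the part of the quantised increment that does not
    grow with T.\<close>
  define C where "C = 2 * log 2 CARD('s) + (log 2 (card ?K * CARD('s)) + 1 + 2 * CARD('s) / M)"
  have "dirinf W P0 z (n + T) Q - dirinf W P0 z n Q \<le> a (n0 + T) + C + e * real T" for T n Q
  proof -
    obtain \<kappa> R where \<kappa>: "\<And>xs zs. \<kappa> xs zs \<in> ?K"
      and le: "dirinf W P0 z (n + T) Q - dirinf W P0 z n Q \<le>
      (\<Sum>k\<in>?K. \<Sum>s\<in>UNIV. occupation W P0 z n Q \<kappa> k s * dirinf W (return_pmf s) z T (R k)) +
      (log 2 (card ?K * CARD('s)) + 1 + 2 * (1 + real T * log 2 CARD('y)) * CARD('s) / M)"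
      by (rule dirinf_diff_quantised[OF M0, where W = W and ?P0.0 = P0 and z = z and n = n and T = T and Q = Q]) (rule that)
    have \<sigma>: "sig n Q \<kappa> \<in> Sigs" using \<kappa> by (auto simp: Sigs_def)
    define n' where "n' = rep (sig n Q \<kappa>)"
    have n': "n' \<le> n0" using \<sigma> \<open>finite Sigs\<close> by (simp add: n0_def n'_def)
    obtain Q' \<kappa>' where \<kappa>': "\<And>xs zs. \<kappa>' xs zs \<in> ?K" and sig: "sig n' Q' \<kappa>' = sig n Q \<kappa>"
      using rep[OF \<sigma>] by (auto simp: n'_def)
    let ?D = "\<lambda>k s. dirinf W (return_pmf s) z T (R k)"
    have occ: "occupation W P0 z n Q \<kappa> k s \<le> occupation W P0 z n' Q' \<kappa>' k s + 1 / real D" if "k \<in> ?K" for k s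
    proof -
      let ?u = "occupation W P0 z n Q \<kappa> k s" and ?v = "occupation W P0 z n' Q' \<kappa>' k s"
      have "nat \<lfloor>real D * ?v\<rfloor> = nat \<lfloor>real D * ?u\<rfloor>"
        using fun_cong[OF sig, of "(k, s)"] that by (simp add: sig_def)
      moreover have "0 \<le> real D * ?u" "0 \<le> real D * ?v" by (simp_all add: occupation_nonneg)
      ultimately have "real D * ?u \<le> real D * ?v + 1" by linarith
      thus ?thesis using D0 by (simp add: field_simps)
    qed
    have "(\<Sum>k\<in>?K. \<Sum>s\<in>UNIV. occupation W P0 z n Q \<kappa> k s * ?D k s) \<le>
      (\<Sum>k\<in>?K. \<Sum>s\<in>UNIV. (occupation W P0 z n' Q' \<kappa>' k s + 1 / real D) * ?D k s)"
      by (intro sum_mono mult_right_mono occ dirinf_nonneg) auto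
    also have "\<dots> \<le> (\<Sum>k\<in>?K. \<Sum>s\<in>UNIV. occupation W P0 z n' Q' \<kappa>' k s * ?D k s + real T * l / real D)"
    proof (intro sum_mono)
      fix k s
      have "1 / real D * ?D k s \<le> 1 / real D * (real T * l)"
        unfolding l_def by (intro mult_left_mono dirinf_le) auto
      thus "(occupation W P0 z n' Q' \<kappa>' k s + 1 / real D) * ?D k s \<le>
        occupation W P0 z n' Q' \<kappa>' k s * ?D k s + real T * l / real D" by (simp add: distrib_right)
    qed
    also have "\<dots> = (\<Sum>k\<in>?K. \<Sum>s\<in>UNIV. occupation W P0 z n' Q' \<kappa>' k s * ?D k s) +
        card ?K * CARD('s) * l / real D * real T"
      by (simp add: sum.distrib)
    finally have 1: "(\<Sum>k\<in>?K. \<Sum>s\<in>UNIV. occupation W P0 z n Q \<kappa> k s * ?D k s) \<le>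
      (\<Sum>k\<in>?K. \<Sum>s\<in>UNIV. occupation W P0 z n' Q' \<kappa>' k s * ?D k s) +
        card ?K * CARD('s) * l / real D * real T" .
    have 2: "card ?K * CARD('s) * l / real D * real T \<le> e / 2 * real T"
      using D D0 e by (intro mult_right_mono) (auto simp: field_simps)
    \<comment> \<open>The information gained before the switch is nonnegative and is
      dropped.\<close>
    have 3: "(\<Sum>k\<in>?K. \<Sum>s\<in>UNIV. occupation W P0 z n' Q' \<kappa>' k s * ?D k s) \<le> a (n' + T) + log 2 CARD('s)"
      using dirinf_switch_policy[where W = W and ?P0.0 = P0 and z = z and n = n' and Q = Q' and T = T and R = R
          and \<kappa> = \<kappa>', OF finite_levels \<kappa>']
        dirinf_le_max[of "n' + T" "switch_policy n' Q' \<kappa>' R"]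
        dirinf_nonneg[where W = W and ?P0.0 = P0 and z = z and N = n' and Q = Q'] by linarith
    have "n' + T + (n0 - n') = n0 + T" using n' by simp
    hence 4: "a (n' + T) \<le> a (n0 + T) + log 2 CARD('s)"
      using max_directed_info_add_ge[of "n' + T" "n0 - n'"] by (simp only:)
    have 5: "2 * l * CARD('s) / M * real T \<le> e / 2 * real T"
      using M M0 e by (intro mult_right_mono) (auto simp: field_simps)
    have 6: "2 * (1 + real T * l) * CARD('s) / M = 2 * CARD('s) / M + 2 * l * CARD('s) / M * real T"
      using M0 by (simp add: field_simps)
    have "e * real T = e / 2 * real T + e / 2 * real T" by simp
    thus ?thesis
      using le 1 2 3 4 5 unfolding l_def[symmetric] C_def 6 by linarith
  qed
  thus ?thesis by blast
qed

text \<open>A horizon N is cut into a remainder of \<open>N mod T\<close> steps, placed first and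
  worth at most \<open>T log |Y|\<close>, followed by \<open>N div T\<close> blocks to which the
  increment bound applies at every starting time.\<close>

lemma convergent_max_directed_info: "convergent (\<lambda>N. 1 / real N * a N)"
proof (rule convergent_average[OF max_directed_info_nonneg max_directed_info_le])
  fix e :: real assume "0 < e"
  then obtain n0 C where inc: "\<And>T n Q. dirinf W P0 z (n + T) Q - dirinf W P0 z n Q \<le> a (n0 + T) + C + e * real T"
    using dirinf_increment_le by blast
  have "a N \<le> real T * log 2 CARD('y) + real (N div T) * (a (n0 + T) + C + e * real T)"
    if "0 < T" for T N
  proof (rule max_directed_info_leI)
    fix Q :: "('x, 'z) input_policy"
    have "dirinf W P0 z (m + q * T) Q \<le> dirinf W P0 z m Q + real q * (a (n0 + T) + C + e * real T)" for m q
    proof (induction q)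
      case (Suc q)
      have "m + Suc q * T = (m + q * T) + T" by simp
      thus ?case using inc[of "m + q * T" T Q] Suc.IH by (simp add: algebra_simps)
    qed simp
    from this[of "N mod T" "N div T"]
    have "dirinf W P0 z N Q \<le> dirinf W P0 z (N mod T) Q + real (N div T) * (a (n0 + T) + C + e * real T)"
      by simp
    moreover have "dirinf W P0 z (N mod T) Q \<le> real (N mod T) * log 2 CARD('y)" by (rule dirinf_le)
    moreover have "real (N mod T) * log 2 CARD('y) \<le> real T * log 2 CARD('y)"
      using that by (intro mult_right_mono) (auto simp: Suc_leI less_imp_le)
    ultimately show "dirinf W P0 z N Q \<le> real T * log 2 CARD('y) + real (N div T) * (a (n0 + T) + C + e * real T)"
      by linarith
  qed
  thus "\<exists>n0 C. \<forall>T N. 0 < T \<longrightarrow> a N \<le> real T * log 2 CARD('y) + real (N div T) * (a (n0 + T) + C + e * real T)"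
    by blast
qed

section \<open>Fano's inequality and the converse\<close>

lemma causal_input_codeword:
  assumes "length xs = length ys"
  shows "causal_input (\<lambda>_ zs. return_pmf (fst c m zs)) xs (map z ys) = (if xs = codeword z c m ys then 1 else 0)"
proof (cases "xs = codeword z c m ys")
  case True
  thus ?thesis by (simp add: causal_input_def codeword_def take_map)
next
  case False
  have "length xs = length (codeword z c m ys)" using assms by (simp add: codeword_def)
  then obtain i where "i < length xs" "xs ! i \<noteq> codeword z c m ys ! i"
    using nth_equalityI False by blast
  hence "\<exists>i<length xs. pmf (return_pmf (fst c m (take i (map z ys)))) (xs ! i) = 0"
    using assms by (intro exI[of _ i]) (auto simp: codeword_def take_map)
  thus ?thesis using False by (auto simp: causal_input_def)
qed

text \<open>Here e is the error probability averaged over equiprobable messages and the initial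
  state. Fano's inequality is obtained from Gibbs' inequality with a test posterior for the message,
  without conditional entropies.\<close>

lemma fano_max_directed_info:
  fixes N :: nat and c :: "('x, 'y, 'z) code"
  assumes M: "0 < M"
  defines "e \<equiv> (\<Sum>m\<in>{1..M}. 1 / real M * (\<Sum>s0\<in>UNIV. pmf P0 s0 * error_prob W z N c m s0))"
  shows "(1 - e) * log 2 M - 1 \<le> a N"
proof -
  have "\<exists>R :: ('x, 'z) input_policy. \<forall>xs zs. length zs = length xs \<longrightarrow>
    (\<Sum>m\<in>{1..M}. 1 / real M) * causal_input R xs zs =
      (\<Sum>m\<in>{1..M}. 1 / real M * causal_input (\<lambda>_ zs. return_pmf (fst c m zs)) xs zs)"
    by (rule exists_mixture_policy) auto
  then obtain R :: "('x, 'z) input_policy" where R: "\<And>xs zs. length zs = length xs \<Longrightarrow>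
    causal_input R xs zs = (\<Sum>m\<in>{1..M}. 1 / real M * causal_input (\<lambda>_ zs. return_pmf (fst c m zs)) xs zs)"
    using M by auto
  define cw where "cw m ys = codeword z c m ys" for m ys
  define p where "p m ys = 1 / real M * chan W P0 (cw m ys) ys" for m ys
  let ?o = "out_mass W P0 z R"
  have cw: "cw m ys \<in> blocks N" if "ys \<in> blocks N" for m ys
    using that by (simp add: cw_def codeword_def blocks_def)
  have sum_R: "(\<Sum>xs\<in>blocks N. path_mass W P0 z R xs ys * F xs) = (\<Sum>m\<in>{1..M}. p m ys * F (cw m ys))"
    if ys: "ys \<in> blocks N" for ys F
  proof -
    have "(\<Sum>xs\<in>blocks N. path_mass W P0 z R xs ys * F xs) =
      (\<Sum>xs\<in>blocks N. \<Sum>m\<in>{1..M}. if xs = cw m ys then 1 / real M * chan W P0 xs ys * F xs else 0)"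
    proof (intro sum.cong refl)
      fix xs :: "'x list" assume "xs \<in> blocks N"
      hence len: "length xs = length ys" using ys by (simp add: blocks_def)
      show "path_mass W P0 z R xs ys * F xs =
        (\<Sum>m\<in>{1..M}. if xs = cw m ys then 1 / real M * chan W P0 xs ys * F xs else 0)"
        unfolding path_mass_def using len
        by (simp only: R length_map causal_input_codeword[OF len] cw_def sum_distrib_right) (auto intro: sum.cong)
    qed
    also have "\<dots> = (\<Sum>m\<in>{1..M}. p m ys * F (cw m ys))"
      using cw[OF ys] by (subst sum.swap) (simp add: p_def)
    finally show ?thesis .
  qed
  have o_eq: "?o ys = (\<Sum>m\<in>{1..M}. p m ys)" if "ys \<in> blocks N" for ys
    using sum_R[OF that, of "\<lambda>_. 1"] that by (simp add: out_mass_def blocks_def)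
  have p0: "0 \<le> p m ys" for m ys by (simp add: p_def chan_nonneg)
  have p_sum: "(\<Sum>m\<in>{1..M}. \<Sum>ys\<in>blocks N. p m ys) = 1"
  proof -
    have "(\<Sum>m\<in>{1..M}. \<Sum>ys\<in>blocks N. p m ys) = (\<Sum>ys\<in>blocks N. ?o ys)"
      by (subst sum.swap) (simp add: o_eq)
    thus ?thesis by (simp only: sum_out_mass)
  qed
  have dir: "dirinf W P0 z N R = (\<Sum>m\<in>{1..M}. \<Sum>ys\<in>blocks N. p m ys * log 2 (chan W P0 (cw m ys) ys / ?o ys))"
  proof -
    have "dirinf W P0 z N R = (\<Sum>ys\<in>blocks N. \<Sum>xs\<in>blocks N. path_mass W P0 z R xs ys * log 2 (chan W P0 xs ys / ?o ys))"
      unfolding directed_info_joint_law by (rule sum.swap)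
    also have "\<dots> = (\<Sum>ys\<in>blocks N. \<Sum>m\<in>{1..M}. p m ys * log 2 (chan W P0 (cw m ys) ys / ?o ys))"
      by (intro sum.cong refl sum_R)
    finally show ?thesis by (subst sum.swap)
  qed
  \<comment> \<open>Divided by M these weights give the decoded message probability 1/2 and every
    other one 1 / (2 M). So the log-likelihood gains log M, less one bit, exactly when decoding is
    correct.\<close>
  let ?w = "\<lambda>m ys. if snd c ys = m then real M / 2 else 1 / 2"
  let ?g = "\<lambda>m ys. log 2 (chan W P0 (cw m ys) ys / ?o ys) - (if snd c ys = m then log 2 M else 0) + 1"
  have "0 \<le> (\<Sum>m\<in>{1..M}. \<Sum>ys\<in>blocks N. p m ys * ?g m ys)"
  proof (rule sum_mult_log_nonneg2[where q = "\<lambda>m ys. ?o ys * (1 / real M * ?w m ys)"])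
    fix m and ys :: "'y list" assume m: "m \<in> {1..M}" and ys: "ys \<in> blocks N" and pos: "0 < p m ys"
    have c: "0 < chan W P0 (cw m ys) ys" using pos M by (simp add: p_def zero_less_divide_iff)
    have "p m ys \<le> ?o ys" unfolding o_eq[OF ys] using m p0 by (intro member_le_sum) auto
    hence o: "0 < ?o ys" using pos by linarith
    show "0 < ?o ys * (1 / real M * ?w m ys) \<and> log 2 (p m ys / (?o ys * (1 / real M * ?w m ys))) \<le> ?g m ys"
      using o c M by (auto simp: p_def log_mult log_divide)
  next
    have w: "(\<Sum>m\<in>{1..M}. 1 / real M * ?w m ys) \<le> 1" for ys
    proof -
      have "(\<Sum>m\<in>{1..M}. ?w m ys) \<le> (\<Sum>m\<in>{1..M}. (if snd c ys = m then real M / 2 else 0) + 1 / 2)"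
        by (intro sum_mono) auto
      also have "\<dots> \<le> real M / 2 + real M / 2" by (simp add: sum.distrib)
      finally have "(\<Sum>m\<in>{1..M}. ?w m ys) \<le> real M" by simp
      thus ?thesis unfolding sum_distrib_left[symmetric] using M by simp
    qed
    have "(\<Sum>m\<in>{1..M}. \<Sum>ys\<in>blocks N. ?o ys * (1 / real M * ?w m ys)) =
      (\<Sum>ys\<in>blocks N. ?o ys * (\<Sum>m\<in>{1..M}. 1 / real M * ?w m ys))"
      by (subst sum.swap) (simp only: sum_distrib_left)
    also have "\<dots> \<le> (\<Sum>ys\<in>blocks N. ?o ys * 1)"
      by (intro sum_mono mult_left_mono w out_mass_nonneg)
    also have "\<dots> = 1" by (simp add: sum_out_mass)
    finally show "(\<Sum>m\<in>{1..M}. \<Sum>ys\<in>blocks N. ?o ys * (1 / real M * ?w m ys)) \<le> (\<Sum>m\<in>{1..M}. \<Sum>ys\<in>blocks N. p m ys)"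
      by (simp only: p_sum)
  qed (auto simp: p0 out_mass_nonneg)
  also have "\<dots> = dirinf W P0 z N R - (\<Sum>m\<in>{1..M}. \<Sum>ys\<in>blocks N. p m ys * (if snd c ys = m then log 2 M else 0)) + 1"
    by (simp only: distrib_left right_diff_distrib sum.distrib sum_subtractf dir mult_1_right p_sum)
  also have "(\<Sum>m\<in>{1..M}. \<Sum>ys\<in>blocks N. p m ys * (if snd c ys = m then log 2 M else 0)) = (1 - e) * log 2 M"
  proof -
    have e: "e = (\<Sum>m\<in>{1..M}. \<Sum>ys\<in>blocks N. if snd c ys \<noteq> m then p m ys else 0)"
      unfolding e_def
    proof (intro sum.cong refl)
      fix m
      have "(\<Sum>s0\<in>UNIV. pmf P0 s0 * error_prob W z N c m s0) =
        (\<Sum>ys | ys \<in> blocks N \<and> snd c ys \<noteq> m. chan W P0 (cw m ys) ys)"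
        unfolding error_prob_def chan_def cw_def sum_distrib_left by (rule sum.swap)
      hence "1 / real M * (\<Sum>s0\<in>UNIV. pmf P0 s0 * error_prob W z N c m s0) =
        (\<Sum>ys | ys \<in> blocks N \<and> snd c ys \<noteq> m. p m ys)"
        by (simp only: p_def sum_distrib_left)
      also have "\<dots> = (\<Sum>ys\<in>blocks N. if snd c ys \<noteq> m then p m ys else 0)"
        by (rule sum.inter_filter) simp
      finally show "1 / real M * (\<Sum>s0\<in>UNIV. pmf P0 s0 * error_prob W z N c m s0) =
        (\<Sum>ys\<in>blocks N. if snd c ys \<noteq> m then p m ys else 0)" .
    qed
    have "1 - e = (\<Sum>m\<in>{1..M}. \<Sum>ys\<in>blocks N. p m ys - (if snd c ys \<noteq> m then p m ys else 0))"
      by (simp only: e sum_subtractf p_sum)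
    thus ?thesis by (simp only: sum_distrib_right) (auto intro!: sum.cong)
  qed
  finally show ?thesis using dirinf_le_max[of N R] by linarith
qed

lemma num_messages_ge: "2 powr (real N * R) \<le> real (num_messages N R)"
  unfolding num_messages_def using real_nat_ceiling_ge by blast

lemma num_messages_pos: "0 < num_messages N R"
  by (simp add: num_messages_def)

text \<open>The maximal error vanishes for each of the finitely many initial states, hence so does
  its average \<open>E\<close> under \<open>P0\<close>; Fano's inequality divided by N then passes
  to the limit.\<close>

lemma achievable_le_lim:
  assumes "achievable W z R"
  shows "R \<le> lim (\<lambda>N. 1 / real N * a N)"
proof -
  from assms obtain c :: "nat \<Rightarrow> ('x, 'y, 'z) code" where c:
    "\<And>s0. (\<lambda>N. MAX m\<in>{1..num_messages N R}. error_prob W z N (c N) m s0) \<longlonglongrightarrow> 0"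
    by (auto simp: achievable_def)
  define E where "E N = (\<Sum>s0\<in>UNIV. pmf P0 s0 * (MAX m\<in>{1..num_messages N R}. error_prob W z N (c N) m s0))" for N
  have "E \<longlonglongrightarrow> (\<Sum>s0\<in>UNIV. pmf P0 s0 * 0)"
    unfolding E_def by (intro tendsto_sum tendsto_mult tendsto_const c)
  hence E: "E \<longlonglongrightarrow> 0" by simp
  \<comment> \<open>The factor 1 - E N is positive, so it may multiply N R <= log M whatever the
    sign of R.\<close>
  have bound: "(1 - E N) * R - 1 / real N \<le> 1 / real N * a N" if "0 < N" "E N < 1" for N
  proof -
    let ?M = "num_messages N R"
    let ?e = "\<Sum>m\<in>{1..?M}. 1 / real ?M * (\<Sum>s0\<in>UNIV. pmf P0 s0 * error_prob W z N (c N) m s0)"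
    have "?e \<le> (\<Sum>m\<in>{1..?M}. 1 / real ?M * E N)"
      unfolding E_def by (intro sum_mono mult_left_mono Max_ge) auto
    also have "\<dots> = E N" using num_messages_pos[of N R] by simp
    finally have eE: "?e \<le> E N" .
    have "real N * R \<le> log 2 ?M"
      using num_messages_ge[of N R] num_messages_pos[of N R] by (simp add: le_log_iff)
    hence "(1 - E N) * (real N * R) \<le> (1 - E N) * log 2 ?M"
      using that by (intro mult_left_mono) auto
    also have "\<dots> \<le> (1 - ?e) * log 2 ?M"
      using eE num_messages_pos[of N R] by (intro mult_right_mono) (auto simp: Suc_leI)
    finally have "(1 - E N) * (real N * R) - 1 \<le> a N"
      using fano_max_directed_info[OF num_messages_pos, of N R N "c N"] by linarith
    hence "((1 - E N) * (real N * R) - 1) / real N \<le> a N / real N" by (rule divide_right_mono) simp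
    thus ?thesis using that by (simp add: diff_divide_distrib)
  qed
  show ?thesis
  proof (rule tendsto_le[OF sequentially_bot])
    show "(\<lambda>N. 1 / real N * a N) \<longlonglongrightarrow> lim (\<lambda>N. 1 / real N * a N)"
      using convergent_max_directed_info by (simp only: convergent_LIMSEQ_iff)
    have "(\<lambda>N. (1 - E N) * R - 1 / real N) \<longlonglongrightarrow> (1 - 0) * R - 0"
      by (intro tendsto_intros E lim_1_over_n)
    thus "(\<lambda>N. (1 - E N) * R - 1 / real N) \<longlonglongrightarrow> R" by simp
    have "\<forall>\<^sub>F N in sequentially. E N < 1" using E by (intro order_tendstoD(2)) auto
    with eventually_gt_at_top[of 0] show "\<forall>\<^sub>F N in sequentially. (1 - E N) * R - 1 / real N \<le> 1 / real N * a N"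
      by eventually_elim (rule bound)
  qed
qed

text \<open>Makes the set of achievable rates nonempty, so that \<open>cSup_least\<close> applies.
  At rate 0 there is a single message, and the constant decoder never errs.\<close>

lemma achievable_0: "achievable W z 0"
  unfolding achievable_def
proof (intro exI conjI allI)
  let ?c = "\<lambda>N :: nat. ((\<lambda>_ _. undefined, \<lambda>_. 1) :: ('x, 'y, 'z) code)"
  show "is_code N (num_messages N 0) (?c N)" for N by (simp add: is_code_def num_messages_def)
  show "(\<lambda>N. MAX m\<in>{1..num_messages N 0}. error_prob W z N (?c N) m s0) \<longlonglongrightarrow> 0" for s0
    by (simp add: num_messages_def error_prob_def)
qed

end

theorem theorem15:
  fixes W :: "'x::finite \<Rightarrow> 's::finite \<Rightarrow> ('y::finite \<times> 's) pmf"
    and P0 :: "'s pmf"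
    and z :: "'y \<Rightarrow> 'z::finite"
  shows "convergent (\<lambda>N. 1 / real N * max_directed_info W P0 z N)
       \<and> feedback_capacity W z \<le> lim (\<lambda>N. 1 / real N * max_directed_info W P0 z N)"
proof
  show "convergent (\<lambda>N. 1 / real N * max_directed_info W P0 z N)"
    by (rule convergent_max_directed_info)
  show "feedback_capacity W z \<le> lim (\<lambda>N. 1 / real N * max_directed_info W P0 z N)"
    unfolding feedback_capacity_def
    by (rule cSup_least) (use achievable_0 achievable_le_lim in auto)
qed

end
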